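(* Let $H$ be a fixed connected graph (possibly with self-loops) and let $G$ be the $n$-vertex path. Let $\Omega'$ be the state space of the Glauber dynamics $\mathcal{M}_{\mathrm{Gl}}$, which is either the set of all (proper) $H$-colorings of $G$ (if $H$ is not bipartite) or one of the two maximum sets of compatible $H$-colorings of $G$ (if $H$ is bipartite). Consider the Markov chain $\mathcal{M}_{\mathrm{Gl}}$ on the state space $\Omega'$. Then $$\mathrm{Mix}(\mathcal{M}_{\mathrm{Gl}},\varepsilon)=O(n^5\ln\varepsilon^{-1}).$$
   Context: The $n$-vertex path has vertices $1,\dots,n$ and edges $\{i,i+1\}$. $H$ is a finite undirected graph, regarded as fixed (so its number of vertices is treated as a constant). An $H$-coloring of $G$ is a graph homomorphism from $G$ to $H$, that is, a map $\sigma:V(G)\to V(H)$, $i\mapsto\sigma_i$, such that $\sigma_i\sigma_j$ is an edge of $H$ (possibly a loop) whenever $ij$ is an edge of $G$. A graph with a self-loop has an odd cycle and so is not bipartite. If $H$ is bipartite (and connected), two $H$-colorings $\sigma,\tau$ are compatible if $\sigma_1$ and $\tau_1$ lie on the same side of the bipartition of $H$; this partitions the $H$-colorings into two sets. The procedure Metropolis($v$): choose a color $c\in V(H)$ uniformly at random and propose recoloring $v$ with $c$; the proposal is accepted if and only if every neighbor $w$ of $v$ in $G$ is colored with a neighbor (in $H$) of $c$; otherwise the coloring is unchanged. One step of $\mathcal{M}_{\mathrm{Gl}}$ (Glauber dynamics): choose a vertex $v$ of $G$ uniformly at random and do Metropolis($v$). The chain is ergodic on $\Omega'$ with uniform stationary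 distribution. For a Markov chain $\mathcal{M}$ with transition matrix $P$ and stationary distribution $\pi$, $\mathrm{Mix}_x(\mathcal{M},\varepsilon)=\min\{t>0:\mathrm{d_{TV}}(P^t(x,\cdot),\pi(\cdot))\le\varepsilon\}$ and $\mathrm{Mix}(\mathcal{M},\varepsilon)=\max_x\mathrm{Mix}_x(\mathcal{M},\varepsilon)$, where $\mathrm{d_{TV}}(\theta_1,\theta_2)=\frac12\sum_i|\theta_1(i)-\theta_2(i)|$. *)

theory Defs
  imports "HOL-Probability.Probability" "Graph_Theory.Graph_Theory"
begin

text \<open>
  A finite undirected graph, possibly with loops, is a \<^locale>\<open>pair_pseudo_graph\<close>: finitely many
  vertices and a symmetric set of ordered pairs of vertices as arcs; a loop at \<open>v\<close> is the
  arc \<open>(v, v)\<close>.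
\<close>

definition path_graph :: "nat \<Rightarrow> nat pair_pre_digraph" where
  "path_graph n =
     \<lparr>pverts = {1..n}, parcs = {(i, j). i \<in> {1..n} \<and> j \<in> {1..n} \<and> (j = i + 1 \<or> i = j + 1)}\<rparr>"

text \<open>Colorings are extensional, so that distinct elements differ on a vertex of \<open>G\<close>.\<close>

definition colorings :: "'v pair_pre_digraph \<Rightarrow> 'c pair_pre_digraph \<Rightarrow> ('v \<Rightarrow> 'c) set" where
  "colorings G H =
     {\<sigma> \<in> pverts G \<rightarrow>\<^sub>E pverts H. \<forall>(v, w) \<in> parcs G. (\<sigma> v, \<sigma> w) \<in> parcs H}"

definition bipartition :: "'c pair_pre_digraph \<Rightarrow> 'c set \<Rightarrow> 'c set \<Rightarrow> bool" where
  "bipartition H A B \<longleftrightarrow> A \<union> B = pverts H \<and> A \<inter> B = {} \<and> parcs H \<subseteq> A \<times> B \<union> B \<times> A"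

definition bipartite :: "'c pair_pre_digraph \<Rightarrow> bool" where
  "bipartite H \<longleftrightarrow> (\<exists>A B. bipartition H A B)"

text \<open>
  Both sides are covered, since \<open>bipartition H A B\<close> is symmetric in \<open>A\<close> and \<open>B\<close>; for connected
  \<open>H\<close> the two sides are unique up to exchanging them.
\<close>

definition compatible :: "'c pair_pre_digraph \<Rightarrow> (nat \<Rightarrow> 'c) \<Rightarrow> (nat \<Rightarrow> 'c) \<Rightarrow> bool" where
  "compatible H \<sigma> \<tau> \<longleftrightarrow> (\<exists>A B. bipartition H A B \<and> \<sigma> 1 \<in> A \<and> \<tau> 1 \<in> A)"

text \<open>
  The possible state spaces for the \<open>n\<close>-vertex path: for bipartite \<open>H\<close>, the classes into which
  compatibility partitions the colorings. The Glauber dynamics stays in such a class only for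
  \<open>n \<ge> 2\<close>: on the one-vertex path every proposal is accepted, also those changing the side.
\<close>

definition glauber_state_spaces :: "'c pair_pre_digraph \<Rightarrow> nat \<Rightarrow> (nat \<Rightarrow> 'c) set set" where
  "glauber_state_spaces H n =
     (let \<Omega> = colorings (path_graph n) H
      in if bipartite H then \<Omega> // {(\<sigma>, \<tau>) \<in> \<Omega> \<times> \<Omega>. compatible H \<sigma> \<tau>} else {\<Omega>})"

definition metropolis ::
    "'v pair_pre_digraph \<Rightarrow> 'c pair_pre_digraph \<Rightarrow> 'v \<Rightarrow> ('v \<Rightarrow> 'c) \<Rightarrow> ('v \<Rightarrow> 'c) pmf" where
  "metropolis G H v \<sigma> =
     map_pmf
       (\<lambda>c. if \<forall>w. (v, w) \<in> parcs G \<longrightarrow> (c, \<sigma> w) \<in> parcs H then \<sigma>(v := c) else \<sigma>)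
       (pmf_of_set (pverts H))"

definition glauber ::
    "'v pair_pre_digraph \<Rightarrow> 'c pair_pre_digraph \<Rightarrow> ('v \<Rightarrow> 'c) \<Rightarrow> ('v \<Rightarrow> 'c) pmf" where
  "glauber G H \<sigma> = bind_pmf (pmf_of_set (pverts G)) (\<lambda>v. metropolis G H v \<sigma>)"

text \<open>
  A Markov chain is given by its transition kernel \<open>K\<close>, with transition matrix
  \<open>P(x, y) = pmf (K x) y\<close>; then \<open>P\<^sup>t(x, y) = pmf (kernel_pow K t x) y\<close>.
\<close>

primrec kernel_pow :: "('s \<Rightarrow> 's pmf) \<Rightarrow> nat \<Rightarrow> 's \<Rightarrow> 's pmf" where
  "kernel_pow K 0 x = return_pmf x"
| "kernel_pow K (Suc t) x = bind_pmf (kernel_pow K t x) K"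

definition tv_dist :: "'s set \<Rightarrow> 's pmf \<Rightarrow> 's pmf \<Rightarrow> real" where
  "tv_dist S p q = (\<Sum>y\<in>S. \<bar>pmf p y - pmf q y\<bar>) / 2"

text \<open>
  \<open>S\<close> is the finite state space and \<open>\<pi>\<close> the stationary distribution. The infimum in \<^typ>\<open>enat\<close>
  is the minimum if the set is nonempty, and infinite otherwise. As \<open>t > 0\<close>, mixing times are at
  least 1 for every \<open>\<epsilon>\<close>, so a bound proportional to \<open>ln (1 / \<epsilon>)\<close> needs \<open>\<epsilon>\<close> bounded away from 1.
\<close>

definition mixing_time_from ::
    "'s set \<Rightarrow> ('s \<Rightarrow> 's pmf) \<Rightarrow> 's pmf \<Rightarrow> real \<Rightarrow> 's \<Rightarrow> enat" where
  "mixing_time_from S K \<pi> \<epsilon> x =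
     Inf {enat t |t. t > 0 \<and> tv_dist S (kernel_pow K t x) \<pi> \<le> \<epsilon>}"

definition mixing_time :: "'s set \<Rightarrow> ('s \<Rightarrow> 's pmf) \<Rightarrow> 's pmf \<Rightarrow> real \<Rightarrow> enat" where
  "mixing_time S K \<pi> \<epsilon> = (SUP x\<in>S. mixing_time_from S K \<pi> \<epsilon> x)"

end

theory Submission
  imports Defs
begin

text \<open>
  The proof bounds the spectral gap by canonical paths. The Glauber dynamics is symmetric, hence
  reversible for the uniform distribution, and stays put with probability at least \<open>1 / q\<close>, where \<open>q\<close>
  is the number of colors, because proposing the present color changes nothing. For such a chain a
  Poincare inequality with constant \<open>R\<close> makes the \<open>\<ell>\<^sup>2\<close> distance to uniformity decay like
  \<open>exp (- t / (q * R))\<close>, and as there are at most \<open>q ^ n\<close> states, a time of order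
  \<open>q * R * (n + ln (1 / \<epsilon>))\<close> suffices (\<open>mixing_time_le\<close>). It remains to show the Poincare inequality
  with \<open>R\<close> of order \<open>n ^ 4\<close>.

  A coloring of the path is a walk in \<open>H\<close>. To move from \<open>x\<close> to \<open>y\<close>, write down \<open>x\<close>, a connecting walk of
  bounded length, and \<open>y\<close>, and slide a window of length \<open>n\<close> along this word. The window can be advanced
  by two positions through \<open>n\<close> recolorings, one vertex after the other, and all intermediate words are
  walks. For this the offset between \<open>x\<close> and \<open>y\<close> must be even, and a connecting walk of the right
  parity is what belonging to the same class of colorings provides. The path has length of order
  \<open>n\<^sup>2\<close>, and a given recoloring can take place at \<open>O(n)\<close> of its times, since the vertex is prescribed and
  only the position of the window is free.

  The number of pairs \<open>(x, y)\<close> that show a given state at a given time is at most a constant times the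
  number \<open>N\<close> of colorings: the state reveals the middle part of the word, and the beginning of \<open>x\<close> and
  the end of \<open>y\<close>, which it does not reveal, have together about \<open>n\<close> letters and can be stored in another
  coloring, up to boundedly many letters (\<open>fibre_bound\<close>). So every recoloring is used by \<open>O(n * N)\<close>
  paths of length \<open>O(n\<^sup>2)\<close>. As each recoloring has probability \<open>1 / (n * q)\<close>, this gives \<open>R = O(n ^ 4)\<close>.
\<close>

section \<open>Symmetric Markov chains with a Poincare inequality\<close>

text \<open>
The variance of \<open>f\<close> under \<open>p\<close> is \<open>\<Sum>y. p y * (f y - f x)\<^sup>2\<close> minus the squared mean of \<open>f - f x\<close>. That
mean ignores the atom at \<open>x\<close>, so by Cauchy-Schwarz its square is at most \<open>1 - p x\<close> times the same
sum. An atom at \<open>x\<close> therefore turns spread around \<open>f x\<close> into variance. Applied to the rows of a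
transition matrix, this bounds the loss of \<open>\<ell>\<^sup>2\<close> norm in one step from below, whatever the sign of
the eigenvalues.
\<close>

lemma variance_ge_holding:
  fixes p f :: "'s \<Rightarrow> real"
  assumes S: "finite S" "x \<in> S" and p: "\<And>y. y \<in> S \<Longrightarrow> 0 \<le> p y" "sum p S = 1" and \<alpha>: "\<alpha> \<le> p x"
  shows "(\<Sum>y\<in>S. p y * f y)\<^sup>2 + \<alpha> * (\<Sum>y\<in>S. p y * (f y - f x)\<^sup>2) \<le> (\<Sum>y\<in>S. p y * (f y)\<^sup>2)"
proof -
  let ?g = "\<lambda>y. f y - f x"
  define D where "D = (\<Sum>y\<in>S. p y * (?g y)\<^sup>2)"
  have D0: "D \<ge> 0" unfolding D_def by (intro sum_nonneg mult_nonneg_nonneg p) auto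
  have mean: "(\<Sum>y\<in>S. p y * ?g y) = (\<Sum>y\<in>S. p y * f y) - f x"
    using p(2) by (simp add: right_diff_distrib sum_subtractf flip: sum_distrib_right)
  have "D = (\<Sum>y\<in>S. p y * (f y)\<^sup>2 - 2 * f x * (p y * f y) + p y * (f x)\<^sup>2)"
    unfolding D_def by (intro sum.cong) (auto simp: power2_eq_square algebra_simps)
  also have "\<dots> = (\<Sum>y\<in>S. p y * (f y)\<^sup>2) - 2 * f x * (\<Sum>y\<in>S. p y * f y) + (f x)\<^sup>2"
    by (simp add: sum.distrib sum_subtractf p(2) flip: sum_distrib_left sum_distrib_right)
  finally have D_eq: "(\<Sum>y\<in>S. p y * (f y)\<^sup>2) - (\<Sum>y\<in>S. p y * f y)\<^sup>2 = D - (\<Sum>y\<in>S. p y * ?g y)\<^sup>2"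
    unfolding mean by (simp add: power2_eq_square algebra_simps)
  have "(\<Sum>y\<in>S. p y * ?g y) = (\<Sum>y\<in>S-{x}. p y * ?g y)"
    by (subst sum.remove[OF S]) simp
  also have "\<dots> = (\<Sum>y\<in>S-{x}. sqrt (p y) * (sqrt (p y) * ?g y))"
    using p(1) by (intro sum.cong) (auto simp flip: mult.assoc)
  finally have "(\<Sum>y\<in>S. p y * ?g y)\<^sup>2 \<le> (\<Sum>y\<in>S-{x}. (sqrt (p y))\<^sup>2) * (\<Sum>y\<in>S-{x}. (sqrt (p y) * ?g y)\<^sup>2)"
    by (simp add: Cauchy_Schwarz_ineq_sum)
  also have "(\<Sum>y\<in>S-{x}. (sqrt (p y))\<^sup>2) = (\<Sum>y\<in>S-{x}. p y)"
    using p(1) by (intro sum.cong) auto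
  also have "\<dots> = 1 - p x" using sum.remove[OF S, of p] p(2) by simp
  also have "(\<Sum>y\<in>S-{x}. (sqrt (p y) * ?g y)\<^sup>2) = (\<Sum>y\<in>S-{x}. p y * (?g y)\<^sup>2)"
    using p(1) by (intro sum.cong) (auto simp: power_mult_distrib)
  also have "\<dots> = D" unfolding D_def by (subst sum.remove[OF S, of "\<lambda>y. p y * (?g y)\<^sup>2"]) simp
  also have "(1 - p x) * D \<le> (1 - \<alpha>) * D" using \<alpha> D0 by (intro mult_right_mono) auto
  finally show ?thesis using D_eq unfolding D_def[symmetric] by (simp add: algebra_simps)
qed

locale symmetric_chain =
  fixes S :: "'s set" and K :: "'s \<Rightarrow> 's pmf"
  assumes finite_states: "finite S"
    and nonempty: "S \<noteq> {}"
    and closed: "x \<in> S \<Longrightarrow> set_pmf (K x) \<subseteq> S"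
    and symmetric: "x \<in> S \<Longrightarrow> y \<in> S \<Longrightarrow> pmf (K x) y = pmf (K y) x"
begin

definition step :: "('s \<Rightarrow> real) \<Rightarrow> 's \<Rightarrow> real" where
  "step f x = (\<Sum>y\<in>S. pmf (K x) y * f y)"

text \<open>
Twice the Dirichlet form of the chain, up to the normalising factor \<open>card S\<close> of the uniform
distribution.
\<close>

definition energy :: "('s \<Rightarrow> real) \<Rightarrow> real" where
  "energy f = (\<Sum>x\<in>S. \<Sum>y\<in>S. pmf (K x) y * (f y - f x)\<^sup>2)"

lemma row_sum: "x \<in> S \<Longrightarrow> (\<Sum>y\<in>S. pmf (K x) y) = 1"
  using sum_pmf_eq_1[OF finite_states closed] by simp

lemma column_sum:
  assumes "y \<in> S" shows "(\<Sum>x\<in>S. pmf (K x) y) = 1"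
proof -
  have "(\<Sum>x\<in>S. pmf (K x) y) = (\<Sum>x\<in>S. pmf (K y) x)"
    using assms symmetric by (intro sum.cong) auto
  then show ?thesis using row_sum[OF assms] by simp
qed

lemma sum_step: "(\<Sum>x\<in>S. step f x) = (\<Sum>x\<in>S. f x)"
  unfolding step_def by (subst sum.swap) (simp add: column_sum flip: sum_distrib_right)

text \<open>
The columns of the transition matrix sum to one as well, so averaging \<open>(f y)\<^sup>2\<close> over a row and summing
over all rows recovers the \<open>\<ell>\<^sup>2\<close> norm; what is lost is the sum of the variances of \<open>f\<close> under the rows.
\<close>

lemma energy_loss:
  assumes "\<And>x. x \<in> S \<Longrightarrow> \<alpha> \<le> pmf (K x) x"
  shows "(\<Sum>x\<in>S. (step f x)\<^sup>2) + \<alpha> * energy f \<le> (\<Sum>x\<in>S. (f x)\<^sup>2)"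
proof -
  have "(\<Sum>x\<in>S. (step f x)\<^sup>2) + \<alpha> * energy f
      = (\<Sum>x\<in>S. (step f x)\<^sup>2 + \<alpha> * (\<Sum>y\<in>S. pmf (K x) y * (f y - f x)\<^sup>2))"
    by (simp add: sum.distrib energy_def sum_distrib_left)
  also have "\<dots> \<le> (\<Sum>x\<in>S. step (\<lambda>y. (f y)\<^sup>2) x)"
    unfolding step_def using assms finite_states
    by (intro sum_mono variance_ge_holding) (auto simp: row_sum)
  finally show ?thesis by (simp add: sum_step)
qed

text \<open>
For \<open>f\<close> of mean zero, the sum of all \<open>(f x - f y)\<^sup>2\<close> is \<open>2 * card S\<close> times the squared norm. The
Poincare inequality thus bounds the norm by the energy, which bounds the loss in one step.
\<close>

lemma l2_contraction:
  fixes \<alpha> R :: real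
  assumes hold: "\<And>x. x \<in> S \<Longrightarrow> \<alpha> \<le> pmf (K x) x" and "0 \<le> \<alpha>" "0 < R"
    and poincare: "(\<Sum>x\<in>S. \<Sum>y\<in>S. (f x - f y)\<^sup>2) \<le> R * card S * energy f"
    and mean: "(\<Sum>x\<in>S. f x) = 0"
  shows "(\<Sum>x\<in>S. (step f x)\<^sup>2) \<le> exp (- (2 * \<alpha> / R)) * (\<Sum>x\<in>S. (f x)\<^sup>2)"
proof -
  let ?Q = "\<Sum>x\<in>S. (f x)\<^sup>2"
  have N: "real (card S) > 0" using finite_states nonempty by (simp add: card_gt_0_iff)
  have "(\<Sum>x\<in>S. \<Sum>y\<in>S. (f x - f y)\<^sup>2) = (\<Sum>x\<in>S. \<Sum>y\<in>S. (f x)\<^sup>2 + (f y)\<^sup>2 - 2 * f x * f y)"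
    by (intro sum.cong) (auto simp: power2_eq_square algebra_simps)
  also have "\<dots> = 2 * card S * ?Q"
    by (simp add: sum.distrib sum_subtractf mean flip: sum_distrib_left sum_distrib_right)
  finally have "2 * ?Q * card S \<le> R * energy f * card S" using poincare by (simp add: algebra_simps)
  with N have "2 * ?Q \<le> R * energy f" by simp
  then have "2 / R * ?Q \<le> energy f" using \<open>0 < R\<close> by (simp add: field_simps)
  from mult_left_mono[OF this \<open>0 \<le> \<alpha>\<close>] energy_loss[OF hold, of f]
  have "(\<Sum>x\<in>S. (step f x)\<^sup>2) \<le> (1 + - (2 * \<alpha> / R)) * ?Q" by (simp add: algebra_simps)
  also have "\<dots> \<le> exp (- (2 * \<alpha> / R)) * ?Q"
    by (intro mult_right_mono exp_ge_add_one_self sum_nonneg) auto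
  finally show ?thesis .
qed

lemma set_pmf_kernel_pow: "x \<in> S \<Longrightarrow> set_pmf (kernel_pow K t x) \<subseteq> S"
  by (induction t) (use closed in auto)

lemma pmf_kernel_pow_Suc:
  assumes "x \<in> S" "y \<in> S"
  shows "pmf (kernel_pow K (Suc t) x) y = step (pmf (kernel_pow K t x)) y"
proof -
  have "pmf (kernel_pow K (Suc t) x) y = (\<Sum>z\<in>S. pmf (kernel_pow K t x) z * pmf (K z) y)"
    using set_pmf_kernel_pow[OF assms(1)] finite_states
    by (subst kernel_pow.simps, subst pmf_bind, subst integral_measure_pmf[where A = S]) auto
  also have "\<dots> = step (pmf (kernel_pow K t x)) y"
    unfolding step_def using symmetric assms by (intro sum.cong) auto
  finally show ?thesis .
qed

text \<open>
By symmetry, the distribution at time \<open>t\<close>, seen as a function on \<open>S\<close>, evolves by the same operator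
that acts on observables; its deviation from the uniform distribution has mean zero and is
contracted in every step.
\<close>

lemma l2_distance_decay:
  fixes \<alpha> R :: real
  assumes hold: "\<And>x. x \<in> S \<Longrightarrow> \<alpha> \<le> pmf (K x) x" and "0 \<le> \<alpha>" "0 < R"
    and poincare: "\<And>f. (\<Sum>x\<in>S. \<Sum>y\<in>S. (f x - f y)\<^sup>2) \<le> R * card S * energy f"
    and x: "x \<in> S"
  shows "(\<Sum>y\<in>S. (pmf (kernel_pow K t x) y - 1 / card S)\<^sup>2) \<le> exp (- (2 * \<alpha> * t / R))"
proof (induction t)
  let ?N = "real (card S)"
  have N: "?N \<ge> 1" using finite_states nonempty by (simp add: Suc_le_eq card_gt_0_iff)
  case 0
  have "(\<Sum>y\<in>S. (pmf (return_pmf x) y - 1 / ?N)\<^sup>2)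
      = (1 - 1 / ?N)\<^sup>2 + (\<Sum>y\<in>S-{x}. (1 / ?N)\<^sup>2)"
    unfolding sum.remove[OF finite_states x]
    by (intro arg_cong2[where f = "(+)"] sum.cong) (auto simp: indicator_def)
  also have "\<dots> = 1 - 1 / ?N"
  proof -
    have card: "real (card (S - {x})) = ?N - 1"
      using x finite_states N by (simp add: of_nat_diff card_Diff_singleton)
    have "(1 - 1 / r)\<^sup>2 + (r - 1) * (1 / r)\<^sup>2 = 1 - 1 / r" if "r \<ge> 1" for r :: real
      using that by (simp add: field_simps power2_eq_square)
    from this[OF N] show ?thesis by (simp only: sum_constant card)
  qed
  finally show ?case using N by simp
next
  case (Suc t)
  let ?N = "real (card S)"
  have N: "?N > 0" using finite_states nonempty by (simp add: card_gt_0_iff)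
  define g where "g y = pmf (kernel_pow K t x) y - 1 / ?N" for y
  have "(\<Sum>y\<in>S. g y) = 0"
    using sum_pmf_eq_1[OF finite_states set_pmf_kernel_pow[OF x, of t]] N
    by (simp add: g_def sum_subtractf)
  note contr = l2_contraction[OF hold \<open>0 \<le> \<alpha>\<close> \<open>0 < R\<close> poincare this]
  have step_g: "step g y = pmf (kernel_pow K (Suc t) x) y - 1 / ?N" if "y \<in> S" for y
    using row_sum[OF that] unfolding pmf_kernel_pow_Suc[OF x that]
    by (simp add: step_def g_def right_diff_distrib sum_subtractf flip: sum_divide_distrib)
  have "(\<Sum>y\<in>S. (pmf (kernel_pow K (Suc t) x) y - 1 / ?N)\<^sup>2) = (\<Sum>y\<in>S. (step g y)\<^sup>2)"
    by (intro sum.cong) (auto simp: step_g simp del: kernel_pow.simps)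
  also have "\<dots> \<le> exp (- (2 * \<alpha> / R)) * (\<Sum>y\<in>S. (g y)\<^sup>2)" by (rule contr)
  also have "\<dots> \<le> exp (- (2 * \<alpha> / R)) * exp (- (2 * \<alpha> * t / R))"
    using Suc.IH by (simp add: g_def)
  also have "\<dots> = exp (- (2 * \<alpha> * Suc t / R))"
    by (simp add: algebra_simps add_divide_distrib flip: exp_add)
  finally show ?case .
qed

text \<open>
Passing from the \<open>\<ell>\<^sup>2\<close> distance to total variation costs a factor \<open>sqrt (card S)\<close>, which accounts for
the term \<open>ln (card S) / 2\<close>.
\<close>

lemma mixing_time_le:
  fixes \<alpha> R \<epsilon> :: real
  assumes hold: "\<And>x. x \<in> S \<Longrightarrow> \<alpha> \<le> pmf (K x) x" and "0 < \<alpha>" "0 < R"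
    and poincare: "\<And>f. (\<Sum>x\<in>S. \<Sum>y\<in>S. (f x - f y)\<^sup>2) \<le> R * card S * energy f"
    and \<epsilon>: "0 < \<epsilon>"
    and t: "0 < t" "R / \<alpha> * (ln (card S) / 2 + ln (1 / \<epsilon>)) \<le> real t"
  shows "mixing_time S K (pmf_of_set S) \<epsilon> \<le> enat t"
  unfolding mixing_time_def
proof (rule SUP_least)
  fix x assume x: "x \<in> S"
  let ?N = "real (card S)"
  let ?g = "\<lambda>y. pmf (kernel_pow K t x) y - 1 / ?N"
  have N: "?N > 0" using finite_states nonempty by (simp add: card_gt_0_iff)
  have "(\<Sum>y\<in>S. \<bar>?g y\<bar>)\<^sup>2 \<le> (\<Sum>y\<in>S. \<bar>?g y\<bar>\<^sup>2) * ?N"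
    using sum_squared_le_sum_of_squares[of "\<lambda>y. \<bar>?g y\<bar>" S] by simp
  also have "\<dots> \<le> exp (- (2 * \<alpha> * t / R)) * ?N"
    using l2_distance_decay[OF hold _ \<open>0 < R\<close> poincare x, of t] \<open>0 < \<alpha>\<close>
    by (intro mult_right_mono) auto
  also have "\<dots> = exp (ln ?N - 2 * (\<alpha> * t / R))"
    using N by (simp add: exp_diff exp_minus field_simps)
  also have "\<dots> \<le> exp (2 * ln \<epsilon>)"
  proof -
    have "ln ?N / 2 - ln \<epsilon> \<le> \<alpha> * t / R"
      using t(2) \<open>0 < \<alpha>\<close> \<open>0 < R\<close> \<epsilon> by (simp add: field_simps ln_div)
    then show ?thesis by simp
  qed
  also have "\<dots> = \<epsilon>\<^sup>2" using \<epsilon> by (simp add: exp_double)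
  finally have "(\<Sum>y\<in>S. \<bar>?g y\<bar>) \<le> \<epsilon>" using \<epsilon> by (auto intro: power2_le_imp_le)
  moreover have "tv_dist S (kernel_pow K t x) (pmf_of_set S) = (\<Sum>y\<in>S. \<bar>?g y\<bar>) / 2"
    unfolding tv_dist_def using finite_states nonempty by simp
  ultimately have "tv_dist S (kernel_pow K t x) (pmf_of_set S) \<le> \<epsilon>" using \<epsilon> by simp
  then show "mixing_time_from S K (pmf_of_set S) \<epsilon> x \<le> enat t"
    unfolding mixing_time_from_def using t(1) by (intro Inf_lower) auto
qed

end

section \<open>Walks in the target graph\<close>

definition is_walk :: "'c pair_pre_digraph \<Rightarrow> (nat \<Rightarrow> 'c) \<Rightarrow> nat \<Rightarrow> nat \<Rightarrow> bool" where
  "is_walk H w a b \<longleftrightarrow> (\<forall>i. a \<le> i \<longrightarrow> i < b \<longrightarrow> (w i, w (Suc i)) \<in> parcs H)"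

text \<open>
In a connected bipartite graph this relation says that two vertices lie on the same side; in a
connected graph that is not bipartite it always holds. It allows both cases to be treated alike.
\<close>

definition even_linked :: "'c pair_pre_digraph \<Rightarrow> 'c \<Rightarrow> 'c \<Rightarrow> bool" where
  "even_linked H a b \<longleftrightarrow> (\<exists>k. even k \<and> (a, b) \<in> parcs H ^^ k)"

definition coloring_class :: "'c pair_pre_digraph \<Rightarrow> 'c \<Rightarrow> nat \<Rightarrow> (nat \<Rightarrow> 'c) set" where
  "coloring_class H c n = {\<sigma> \<in> colorings (path_graph n) H. even_linked H c (\<sigma> 1)}"

lemma relpow_trans: "(a, b) \<in> R ^^ k \<Longrightarrow> (b, c) \<in> R ^^ l \<Longrightarrow> (a, c) \<in> R ^^ (k + l)"
  by (auto simp: relpow_add)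

lemma is_walk_relpow:
  assumes "is_walk H w a b" "a \<le> i" "i \<le> j" "j \<le> b"
  shows "(w i, w j) \<in> parcs H ^^ (j - i)"
  unfolding relpow_fun_conv
  using assms by (intro exI[of _ "\<lambda>k. w (i + k)"]) (auto simp: is_walk_def)

text \<open>
Two walks are cut and glued together, with a walk of prescribed length between them. This produces
both the long walks along which colorings are moved and the merged colorings used for counting.
\<close>

lemma is_walk_splice:
  assumes x: "is_walk H x a p" and y: "is_walk H y r b" and "p < r"
    and link: "(x p, y r) \<in> parcs H ^^ (r - p)"
  shows "\<exists>w. (\<forall>i\<le>p. w i = x i) \<and> (\<forall>i\<ge>r. w i = y i) \<and> is_walk H w a b"
proof -
  from link obtain g where g: "g 0 = x p" "g (r - p) = y r"
      "\<And>i. i < r - p \<Longrightarrow> (g i, g (Suc i)) \<in> parcs H"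
    unfolding relpow_fun_conv by auto
  define w where "w i = (if i \<le> p then x i else if r \<le> i then y i else g (i - p))" for i
  have mid: "w i = g (i - p)" if "p \<le> i" "i \<le> r" for i
    using that g \<open>p < r\<close> by (cases "i = p"; cases "i = r") (auto simp: w_def)
  have "(w i, w (Suc i)) \<in> parcs H" if "a \<le> i" "i < b" for i
  proof -
    consider "i < p" | "p \<le> i" "i < r" | "r \<le> i" by linarith
    then show ?thesis
    proof cases
      case 1
      then show ?thesis using x that by (auto simp: w_def is_walk_def)
    next
      case 2
      then show ?thesis using g(3)[of "i - p"] by (simp add: mid Suc_diff_le)
    next
      case 3
      then show ?thesis using y that \<open>p < r\<close> by (auto simp: w_def is_walk_def)
    qed
  qed
  moreover have "\<forall>i\<le>p. w i = x i" "\<forall>i\<ge>r. w i = y i" using \<open>p < r\<close> by (auto simp: w_def)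
  ultimately show ?thesis by (auto simp: is_walk_def)
qed

locale connected_target =
  fixes H :: "'c pair_pre_digraph"
  assumes finite_verts: "finite (pverts H)"
    and arcs_in_verts: "parcs H \<subseteq> pverts H \<times> pverts H"
    and sym_arcs: "sym (parcs H)"
    and connected: "a \<in> pverts H \<Longrightarrow> b \<in> pverts H \<Longrightarrow> (a, b) \<in> (parcs H)\<^sup>*"
    and has_arc: "parcs H \<noteq> {}"
begin

lemma relpow_sym: "(a, b) \<in> parcs H ^^ k \<Longrightarrow> (b, a) \<in> parcs H ^^ k"
proof (induction k arbitrary: b)
  case (Suc k)
  then show ?case using symD[OF sym_arcs] by (metis relpow_Suc_E relpow_Suc_I2)
qed auto

lemma neighbour_exists:
  assumes "a \<in> pverts H" shows "\<exists>b. (a, b) \<in> parcs H"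
proof -
  obtain u v where uv: "(u, v) \<in> parcs H" using has_arc by auto
  then have "(a, u) \<in> (parcs H)\<^sup>*" using connected assms arcs_in_verts by auto
  then show ?thesis using uv by (auto elim: converse_rtranclE)
qed

text \<open>
Going back and forth along an arc at \<open>a\<close>. Such an arc exists by \<open>has_arc\<close>: a connected graph with
at least one arc has no isolated vertex.
\<close>

lemma closed_even_walk:
  assumes "a \<in> pverts H" shows "(a, a) \<in> parcs H ^^ (2 * k)"
proof -
  obtain b where "(a, b) \<in> parcs H" "(b, a) \<in> parcs H"
    using neighbour_exists[OF assms] symD[OF sym_arcs] by blast
  then have "(a, a) \<in> parcs H ^^ 2" by (auto simp: numeral_2_eq_2)
  then show ?thesis
    by (induction k) (auto dest: relpow_trans)
qed

text \<open>
Any walk can be prolonged by two by going back and forth at its end, so for fixed ends only the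
parity of the length matters once the length is large. Finiteness of \<open>H\<close> makes one threshold work
for all pairs of ends.
\<close>

lemma walks_of_all_large_lengths:
  "\<exists>D\<ge>1. \<forall>a\<in>pverts H. \<forall>b\<in>pverts H. \<forall>k l.
     (a, b) \<in> parcs H ^^ k \<longrightarrow> even (k + l) \<longrightarrow> D \<le> l \<longrightarrow> (a, b) \<in> parcs H ^^ l"
proof -
  have "\<forall>\<^sub>F l in sequentially. (\<exists>k. (a, b) \<in> parcs H ^^ k \<and> even (k + l)) \<longrightarrow> (a, b) \<in> parcs H ^^ l"
    if ab: "a \<in> pverts H" "b \<in> pverts H" for a b
  proof -
    have *: "\<forall>\<^sub>F l in sequentially. (\<exists>k. (a, b) \<in> parcs H ^^ k \<and> even k = e) \<longrightarrow> even l = e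
        \<longrightarrow> (a, b) \<in> parcs H ^^ l" for e
    proof (cases "\<exists>k. (a, b) \<in> parcs H ^^ k \<and> even k = e")
      case True
      then obtain k where k: "(a, b) \<in> parcs H ^^ k" "even k = e" by auto
      have "(a, b) \<in> parcs H ^^ l" if "k \<le> l" "even l = e" for l
      proof -
        have "l = k + 2 * ((l - k) div 2)" using that k(2) by (auto simp: even_diff_nat)
        then show ?thesis using relpow_trans[OF k(1) closed_even_walk[OF ab(2)]] by metis
      qed
      then show ?thesis unfolding eventually_sequentially by blast
    qed auto
    from *[of True] *[of False] show ?thesis by eventually_elim auto
  qed
  then have "\<forall>\<^sub>F l in sequentially. \<forall>a\<in>pverts H. \<forall>b\<in>pverts H.
      (\<exists>k. (a, b) \<in> parcs H ^^ k \<and> even (k + l)) \<longrightarrow> (a, b) \<in> parcs H ^^ l"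
    by (intro eventually_ball_finite ballI finite_verts) auto
  then obtain D where D: "\<And>l. D \<le> l \<Longrightarrow> \<forall>a\<in>pverts H. \<forall>b\<in>pverts H.
      (\<exists>k. (a, b) \<in> parcs H ^^ k \<and> even (k + l)) \<longrightarrow> (a, b) \<in> parcs H ^^ l"
    unfolding eventually_sequentially by auto
  show ?thesis
  proof (intro exI[of _ "Suc D"] conjI ballI allI impI)
    fix a b k l assume "a \<in> pverts H" "b \<in> pverts H" "(a, b) \<in> parcs H ^^ k" "even (k + l)" "Suc D \<le> l"
    then show "(a, b) \<in> parcs H ^^ l" using D[of l] by fastforce
  qed simp
qed

lemma is_walk_in_verts:
  assumes w: "is_walk H w a b" and "a < b" "a \<le> i" "i \<le> b"
  shows "w i \<in> pverts H"
proof (cases "i < b")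
  case True
  then show ?thesis using assms arcs_in_verts by (auto simp: is_walk_def)
next
  case False
  then have "i = Suc (b - 1)" "a \<le> b - 1" "b - 1 < b" using assms by auto
  then have "(w (b - 1), w i) \<in> parcs H" using w unfolding is_walk_def by metis
  then show ?thesis using arcs_in_verts by auto
qed

lemma even_linked_trans: "even_linked H a b \<Longrightarrow> even_linked H b c \<Longrightarrow> even_linked H a c"
  unfolding even_linked_def using relpow_trans by (metis even_add)

lemma even_linked_sym: "even_linked H a b \<Longrightarrow> even_linked H b a"
  unfolding even_linked_def using relpow_sym by blast

lemma colorings_path_iff:
  "\<sigma> \<in> colorings (path_graph n) H \<longleftrightarrow> \<sigma> \<in> {1..n} \<rightarrow>\<^sub>E pverts H \<and> is_walk H \<sigma> 1 n"
proof -
  have "(\<forall>(v, w)\<in>parcs (path_graph n). (\<sigma> v, \<sigma> w) \<in> parcs H) \<longleftrightarrow> is_walk H \<sigma> 1 n" (is "?L \<longleftrightarrow> ?R")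
  proof
    assume L: ?L
    show ?R unfolding is_walk_def
    proof (intro allI impI)
      fix i assume "1 \<le> i" "i < n"
      then have "(i, Suc i) \<in> parcs (path_graph n)" by (auto simp: path_graph_def)
      with L show "(\<sigma> i, \<sigma> (Suc i)) \<in> parcs H" by blast
    qed
  next
    assume R: ?R
    show ?L
    proof safe
      fix v w assume "(v, w) \<in> parcs (path_graph n)"
      then have "w = Suc v \<and> 1 \<le> v \<and> v < n \<or> v = Suc w \<and> 1 \<le> w \<and> w < n"
        by (auto simp: path_graph_def)
      with R show "(\<sigma> v, \<sigma> w) \<in> parcs H"
        unfolding is_walk_def using symD[OF sym_arcs] by blast
    qed
  qed
  then show ?thesis by (simp add: colorings_def path_graph_def)
qed

lemma coloring_in_verts:
  assumes "\<sigma> \<in> colorings (path_graph n) H" "i \<in> {1..n}" shows "\<sigma> i \<in> pverts H"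
  using assms colorings_path_iff PiE_mem by metis

lemma finite_colorings: "finite (colorings (path_graph n) H)"
proof (rule finite_subset)
  show "colorings (path_graph n) H \<subseteq> {1..n} \<rightarrow>\<^sub>E pverts H" using colorings_path_iff by blast
qed (simp add: finite_PiE finite_verts)

lemma card_colorings_le: "card (colorings (path_graph n) H) \<le> card (pverts H) ^ n"
proof -
  have "card (colorings (path_graph n) H) \<le> card ({1..n} \<rightarrow>\<^sub>E pverts H)"
    using colorings_path_iff by (intro card_mono finite_PiE) (auto simp: finite_verts)
  then show ?thesis by (simp add: card_PiE)
qed

lemma finite_coloring_class: "finite (coloring_class H c n)"
  using finite_colorings by (simp add: coloring_class_def)

lemma coloring_class_iff:
  "\<sigma> \<in> coloring_class H c n \<longleftrightarrow>
     \<sigma> \<in> {1..n} \<rightarrow>\<^sub>E pverts H \<and> is_walk H \<sigma> 1 n \<and> even_linked H c (\<sigma> 1)"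
  by (simp add: coloring_class_def colorings_path_iff)

lemma class_in_verts: "\<sigma> \<in> coloring_class H c n \<Longrightarrow> i \<in> {1..n} \<Longrightarrow> \<sigma> i \<in> pverts H"
  unfolding coloring_class_def using coloring_in_verts by blast

text \<open>
Two colorings in the same class start at evenly linked vertices, and each step along a coloring
changes the parity. The parity of the walks from \<open>x i\<close> to \<open>y j\<close> is therefore that of \<open>i + j\<close>.
\<close>

lemma colorings_linked:
  assumes x: "x \<in> coloring_class H c n" and y: "y \<in> coloring_class H c n"
    and ij: "i \<in> {1..n}" "j \<in> {1..n}"
  shows "\<exists>k. (x i, y j) \<in> parcs H ^^ k \<and> even (k + (i + j))"
proof -
  have "even_linked H (x 1) (y 1)"
    using x y even_linked_sym even_linked_trans unfolding coloring_class_iff by blast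
  then obtain k where k: "even k" "(x 1, y 1) \<in> parcs H ^^ k" by (auto simp: even_linked_def)
  have "(x 1, x i) \<in> parcs H ^^ (i - 1)" "(y 1, y j) \<in> parcs H ^^ (j - 1)"
    using x y ij by (auto simp: coloring_class_iff intro!: is_walk_relpow[where a = 1 and b = n])
  then have "(x i, y j) \<in> parcs H ^^ (i - 1 + k + (j - 1))"
    using relpow_sym relpow_trans k(2) by metis
  moreover have "even (i - 1 + k + (j - 1) + (i + j))" using ij k(1) by auto
  ultimately show ?thesis by blast
qed

section \<open>Classes of colorings as state spaces\<close>

lemma bipartition_walk:
  assumes bip: "bipartition H A B" and a: "a \<in> A" and ab: "(a, b) \<in> parcs H ^^ k"
  shows "b \<in> (if even k then A else B)"
  using ab
proof (induction k arbitrary: b)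
  case (Suc k)
  then obtain u where "(a, u) \<in> parcs H ^^ k" "(u, b) \<in> parcs H" by (auto elim: relpow_Suc_E)
  with Suc.IH[of u] bip show ?case unfolding bipartition_def by (auto split: if_splits)
qed (use a in auto)

lemma compatible_iff_even_linked:
  assumes "bipartite H" "\<sigma> 1 \<in> pverts H" "\<tau> 1 \<in> pverts H"
  shows "compatible H \<sigma> \<tau> \<longleftrightarrow> even_linked H (\<sigma> 1) (\<tau> 1)"
proof
  assume "compatible H \<sigma> \<tau>"
  then obtain A B where AB: "bipartition H A B" "\<sigma> 1 \<in> A" "\<tau> 1 \<in> A" by (auto simp: compatible_def)
  obtain k where k: "(\<sigma> 1, \<tau> 1) \<in> parcs H ^^ k"
    using connected[OF assms(2,3)] by (auto simp: rtrancl_power)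
  then have "even k" using bipartition_walk[OF AB(1,2) k] AB by (auto simp: bipartition_def split: if_splits)
  then show "even_linked H (\<sigma> 1) (\<tau> 1)" using k by (auto simp: even_linked_def)
next
  assume "even_linked H (\<sigma> 1) (\<tau> 1)"
  then obtain k where k: "even k" "(\<sigma> 1, \<tau> 1) \<in> parcs H ^^ k" by (auto simp: even_linked_def)
  obtain A B where AB: "bipartition H A B" using assms(1) by (auto simp: bipartite_def)
  then have BA: "bipartition H B A" by (auto simp: bipartition_def)
  have "\<sigma> 1 \<in> A \<or> \<sigma> 1 \<in> B" using AB assms(2) by (auto simp: bipartition_def)
  then show "compatible H \<sigma> \<tau>"
    using bipartition_walk[OF AB _ k(2)] bipartition_walk[OF BA _ k(2)] k(1) AB BA
    unfolding compatible_def by auto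
qed

text \<open>
If \<open>b\<close> cannot be reached from \<open>a\<close> by an even walk, then there is no closed walk of odd length at \<open>a\<close>:
it could be put in front of an odd walk to \<open>b\<close>. Without odd closed walks, sorting the vertices by the
parity of their walks from \<open>a\<close> gives a bipartition.
\<close>

lemma even_linked_if_not_bipartite:
  assumes nonbip: "\<not> bipartite H" and a: "a \<in> pverts H" and b: "b \<in> pverts H"
  shows "even_linked H a b"
proof (rule ccontr)
  assume no: "\<not> even_linked H a b"
  obtain k where k: "(a, b) \<in> parcs H ^^ k" using connected[OF a b] by (auto simp: rtrancl_power)
  have no_odd: False if "(a, a) \<in> parcs H ^^ l" "odd l" for l
    using no k relpow_trans[OF that(1) k] that(2) unfolding even_linked_def by (metis even_add)
  let ?X = "{v \<in> pverts H. even_linked H a v}"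
  have "bipartition H ?X (pverts H - ?X)"
    unfolding bipartition_def
  proof (intro conjI subsetI)
    fix e assume e: "e \<in> parcs H"
    obtain u v where uv: "e = (u, v)" by (cases e)
    have V: "u \<in> pverts H" "v \<in> pverts H" using e uv arcs_in_verts by auto
    have "even_linked H a u \<noteq> even_linked H a v"
    proof
      assume same: "even_linked H a u = even_linked H a v"
      obtain i j where ij: "(a, u) \<in> parcs H ^^ i" "(a, v) \<in> parcs H ^^ j" "even i = even j"
        using same connected[OF a V(1)] connected[OF a V(2)]
        unfolding even_linked_def rtrancl_power by metis
      have "(a, a) \<in> parcs H ^^ (i + (1 + j))"
        using e uv by (intro relpow_trans[OF ij(1) relpow_trans[OF _ relpow_sym[OF ij(2)]]]) auto
      then show False using no_odd[of "i + (1 + j)"] ij(3) by auto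
    qed
    then show "e \<in> ?X \<times> (pverts H - ?X) \<union> (pverts H - ?X) \<times> ?X" using V uv by auto
  qed auto
  then show False using nonbip unfolding bipartite_def by blast
qed

lemma glauber_state_space_is_class:
  assumes \<Omega>: "\<Omega> \<in> glauber_state_spaces H n" and "n \<ge> 1"
  shows "\<exists>c\<in>pverts H. \<Omega> = coloring_class H c n"
proof (cases "bipartite H")
  case True
  with \<Omega> obtain \<sigma> where \<sigma>: "\<sigma> \<in> colorings (path_graph n) H"
      and \<Omega>_eq: "\<Omega> = {\<tau> \<in> colorings (path_graph n) H. compatible H \<sigma> \<tau>}"
    unfolding glauber_state_spaces_def by (auto simp: Let_def elim!: quotientE)
  have V: "\<tau> 1 \<in> pverts H" if "\<tau> \<in> colorings (path_graph n) H" for \<tau>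
    using coloring_in_verts[OF that, of 1] \<open>n \<ge> 1\<close> by simp
  have "\<Omega> = coloring_class H (\<sigma> 1) n"
    unfolding \<Omega>_eq coloring_class_def using compatible_iff_even_linked[where \<sigma> = \<sigma>, OF True V[OF \<sigma>]] V by blast
  then show ?thesis using V[OF \<sigma>] by auto
next
  case False
  obtain c where c: "c \<in> pverts H" using has_arc arcs_in_verts by auto
  have "even_linked H c (\<tau> 1)" if "\<tau> \<in> colorings (path_graph n) H" for \<tau>
    using even_linked_if_not_bipartite[OF False c] coloring_in_verts[OF that, of 1] \<open>n \<ge> 1\<close> by simp
  then have "\<Omega> = coloring_class H c n"
    using \<Omega> False unfolding glauber_state_spaces_def Let_def coloring_class_def by auto
  then show ?thesis using c by auto
qed

text \<open>
Recoloring can change the class only at the first vertex, and there the new and the old color are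
both adjacent to the color of the second vertex. In the bipartite case this uses \<open>n \<ge> 2\<close>.
\<close>

lemma recoloring_stays_in_class:
  assumes n: "n \<ge> 1" "bipartite H \<Longrightarrow> n \<ge> 2" and c: "c \<in> pverts H"
    and \<sigma>: "\<sigma> \<in> coloring_class H c n" and \<tau>: "\<sigma>(v := a) \<in> colorings (path_graph n) H"
  shows "\<sigma>(v := a) \<in> coloring_class H c n"
proof (cases "bipartite H")
  case False
  from coloring_in_verts[OF \<tau>, of 1] \<open>n \<ge> 1\<close> have "(\<sigma>(v := a)) 1 \<in> pverts H" by simp
  then show ?thesis using \<tau> even_linked_if_not_bipartite[OF False c] by (simp add: coloring_class_def)
next
  case True
  then have "n \<ge> 2" by (rule n)
  show ?thesis
  proof (cases "v = 1")
    case False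
    then show ?thesis using \<sigma> \<tau> by (auto simp: coloring_class_def)
  next
    case v: True
    have "(\<sigma> 1, \<sigma> 2) \<in> parcs H" "(a, \<sigma> 2) \<in> parcs H"
      using \<sigma> \<tau> \<open>n \<ge> 2\<close> v unfolding coloring_class_def colorings_path_iff is_walk_def
      by (auto simp: numeral_2_eq_2 dest!: spec[of _ "Suc 0"])
    then have "(\<sigma> 1, a) \<in> parcs H ^^ 2" using symD[OF sym_arcs] by (auto simp: numeral_2_eq_2)
    then have "even_linked H (\<sigma> 1) a" unfolding even_linked_def by (intro exI[of _ 2]) auto
    then show ?thesis using \<sigma> \<tau> v even_linked_trans by (auto simp: coloring_class_def)
  qed
qed

section \<open>Canonical paths and their congestion\<close>

text \<open>
The window of length \<open>n\<close> onto \<open>w\<close> that starts after position \<open>s\<close> and whose first \<open>k\<close> entries have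
already been moved ahead by two. Moving ahead by two rather than one keeps the intermediate words
walks: where the shifted and the unshifted part meet, the walk takes one step backwards. Passing from
\<open>k\<close> to \<open>k + 1\<close> recolors the single vertex \<open>k + 1\<close>.
\<close>

definition window :: "nat \<Rightarrow> (nat \<Rightarrow> 'c) \<Rightarrow> nat \<Rightarrow> nat \<Rightarrow> nat \<Rightarrow> 'c" where
  "window n w s k i = (if i \<in> {1..n} then if i \<le> k then w (s + 2 + i) else w (s + i) else undefined)"

lemma window_full: "window n w s n = window n w (s + 2) 0"
  by (auto simp: window_def)

lemma window_update:
  assumes "k < n" shows "window n w s k = (window n w s (Suc k)) (Suc k := w (s + Suc k))"
  using assms by (auto simp: window_def)

text \<open>
A window forgets only the letters that lie outside it and, at its ends, a bounded number of letters
that are being overwritten.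
\<close>

lemma window_determines:
  assumes "window n w s k = window n w' s k" "1 \<le> k" "s + 3 \<le> i" "i \<le> s + n"
  shows "w i = w' i"
proof (cases "i \<le> s + 2 + k")
  case True
  with assms(3) obtain l where "i = s + 2 + l" "1 \<le> l" "l \<le> k"
    by (intro that[of "i - (s + 2)"]) auto
  then show ?thesis using fun_cong[OF assms(1), of l] assms(2-) by (auto simp: window_def)
next
  case False
  with assms(3) obtain l where "i = s + l" "k + 2 < l"
    by (intro that[of "i - s"]) auto
  then show ?thesis using fun_cong[OF assms(1), of l] assms(2-) by (auto simp: window_def)
qed

lemma window_in_class:
  assumes w: "is_walk H w 1 (2 * m + n)" and start: "even_linked H c (w 1)"
    and j: "j < m" and n: "n \<ge> 1"
  shows "window n w (2 * j) k \<in> coloring_class H c n"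
proof -
  have V: "w i \<in> pverts H" if "1 \<le> i" "i \<le> 2 * m + n" for i
    using is_walk_in_verts[OF w _ that] j n by simp
  have "window n w (2 * j) k \<in> {1..n} \<rightarrow>\<^sub>E pverts H"
    using j by (auto simp: window_def intro!: V)
  moreover have "is_walk H (window n w (2 * j) k) 1 n"
    unfolding is_walk_def
  proof (intro allI impI)
    fix i assume i: "1 \<le> i" "i < n"
    have arc: "(w l, w (Suc l)) \<in> parcs H" if "1 \<le> l" "l < 2 * m + n" for l
      using w that by (auto simp: is_walk_def)
    consider "i < k" | "i = k" | "k < i" by linarith
    then show "(window n w (2 * j) k i, window n w (2 * j) k (Suc i)) \<in> parcs H"
    proof cases
      case 1
      then show ?thesis using arc[of "2 * j + 2 + i"] i j by (simp add: window_def)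
    next
      case 2
      then show ?thesis using symD[OF sym_arcs arc[of "2 * j + 1 + i"]] i j by (simp add: window_def)
    next
      case 3
      then show ?thesis using arc[of "2 * j + i"] i j by (simp add: window_def)
    qed
  qed
  moreover have "even_linked H c (window n w (2 * j) k 1)"
  proof -
    have "even_linked H (w 1) (w (2 * l + 1))" if "l \<le> m" for l
      unfolding even_linked_def
      using is_walk_relpow[OF w, of 1 "2 * l + 1"] that n by (intro exI[of _ "2 * l"]) auto
    from this[of j] this[of "j + 1"] start even_linked_trans j n show ?thesis
      by (auto simp: window_def numeral_3_eq_3)
  qed
  ultimately show ?thesis by (simp add: coloring_class_iff)
qed

end

lemma sum_le_fibre_bound:
  fixes h :: "'b \<Rightarrow> real" and M :: nat
  assumes "finite A" "finite T" "g ` A \<subseteq> T"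
    and fibre: "\<And>t. t \<in> T \<Longrightarrow> card {a \<in> A. g a = t} \<le> M" and h: "\<And>t. t \<in> T \<Longrightarrow> 0 \<le> h t"
  shows "(\<Sum>a\<in>A. h (g a)) \<le> real M * (\<Sum>t\<in>T. h t)"
proof -
  have "(\<Sum>a\<in>A. h (g a)) = (\<Sum>t\<in>T. \<Sum>a | a \<in> A \<and> g a = t. h (g a))"
    using sum.group[OF assms(1-3), of "\<lambda>a. h (g a)"] by simp
  also have "\<dots> = (\<Sum>t\<in>T. real (card {a \<in> A. g a = t}) * h t)"
    by (intro sum.cong) auto
  also have "\<dots> \<le> (\<Sum>t\<in>T. real M * h t)"
    using fibre h by (intro sum_mono mult_right_mono) auto
  finally show ?thesis by (simp add: sum_distrib_left)
qed

context connected_target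
begin

text \<open>
The lengths from which on, according to \<open>walks_of_all_large_lengths\<close>, only parity matters.
\<close>

definition walk_threshold :: "nat \<Rightarrow> bool" where
  "walk_threshold D \<longleftrightarrow> D \<ge> 1 \<and> (\<forall>a\<in>pverts H. \<forall>b\<in>pverts H. \<forall>k l.
     (a, b) \<in> parcs H ^^ k \<longrightarrow> even (k + l) \<longrightarrow> D \<le> l \<longrightarrow> (a, b) \<in> parcs H ^^ l)"

lemma colorings_linked_by_length:
  assumes D: "walk_threshold D"
    and x: "x \<in> coloring_class H c n" and y: "y \<in> coloring_class H c n"
    and ij: "i \<in> {1..n}" "j \<in> {1..n}" and l: "even (l + (i + j))" "D \<le> l"
  shows "(x i, y j) \<in> parcs H ^^ l"
proof -
  obtain k where k: "(x i, y j) \<in> parcs H ^^ k" "even (k + (i + j))"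
    using colorings_linked[OF x y ij] by auto
  have "x i \<in> pverts H" "y j \<in> pverts H"
    using class_in_verts x y ij by blast+
  moreover have "even (k + l)" using k(2) l(1) by presburger
  ultimately show ?thesis using D k(1) l(2) unfolding walk_threshold_def by blast
qed

text \<open>
The walk along which \<open>x\<close> is moved to \<open>y\<close>: it reads \<open>x\<close>, then a connecting walk, then \<open>y\<close>. The offset
of \<open>y\<close> is even, so that it is reached by moves of length two, and exceeds \<open>n\<close> by at most \<open>D\<close>, so
that few letters are lost in the counting argument.
\<close>

lemma canonical_walk:
  assumes D: "walk_threshold D" and n: "n \<ge> 1" and m: "m = (n + D) div 2"
    and x: "x \<in> coloring_class H c n" and y: "y \<in> coloring_class H c n"
  shows "\<exists>w. (\<forall>i\<in>{1..n}. w i = x i \<and> w (2 * m + i) = y i) \<and> is_walk H w 1 (2 * m + n)"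
proof -
  have D1: "D \<ge> 1" using D by (simp add: walk_threshold_def)
  have "n < 2 * m + 1" using m D1 by auto
  moreover have "(x n, y (2 * m + 1 - 2 * m)) \<in> parcs H ^^ (2 * m + 1 - n)"
    using n D1 m by (intro colorings_linked_by_length[OF D x y]) auto
  moreover have "is_walk H (\<lambda>i. y (i - 2 * m)) (2 * m + 1) (2 * m + n)"
    using y by (auto simp: coloring_class_iff is_walk_def Suc_diff_le)
  moreover have "is_walk H x 1 n" using x by (simp add: coloring_class_iff)
  ultimately obtain w where "\<forall>i\<le>n. w i = x i" "\<forall>i\<ge>2 * m + 1. w i = y (i - 2 * m)"
      "is_walk H w 1 (2 * m + n)"
    using is_walk_splice[of H x 1 n "\<lambda>i. y (i - 2 * m)" "2 * m + 1" "2 * m + n"] by blast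
  then show ?thesis by (intro exI[of _ w]) auto
qed

text \<open>
A beginning of \<open>x\<close> and an end of \<open>y\<close> with about \<open>n\<close> letters in total are encoded in one coloring. When there
is no room for the connecting walk, one of \<open>x\<close> and \<open>y\<close> serves by itself.
\<close>

lemma splice_colorings:
  assumes D: "walk_threshold D" and n: "n \<ge> 1"
    and x: "x \<in> coloring_class H c n" and y: "y \<in> coloring_class H c n"
  shows "\<exists>u\<in>coloring_class H c n.
    (\<forall>i\<in>{1..n}. (i \<le> 2 * j \<longrightarrow> u i = x i) \<and> (2 * j + D \<le> i \<longrightarrow> u i = y i))"
proof -
  have D1: "D \<ge> 1" using D by (simp add: walk_threshold_def)
  consider "j = 0" | "n < 2 * j + D" | "j \<ge> 1" "2 * j + D \<le> n" by linarith
  then show ?thesis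
  proof cases
    case 1
    then show ?thesis using y by auto
  next
    case 2
    then show ?thesis using x by auto
  next
    case 3
    have "(x (2 * j), y (2 * j + D)) \<in> parcs H ^^ (2 * j + D - 2 * j)"
      using 3 by (intro colorings_linked_by_length[OF D x y]) auto
    moreover have "is_walk H x 1 (2 * j)" "is_walk H y (2 * j + D) n"
      using x y 3 by (auto simp: coloring_class_iff is_walk_def)
    ultimately obtain w where w: "\<forall>i\<le>2 * j. w i = x i" "\<forall>i\<ge>2 * j + D. w i = y i" "is_walk H w 1 n"
      using is_walk_splice[of H x 1 "2 * j" y "2 * j + D" n] D1 by auto
    have "restrict w {1..n} \<in> coloring_class H c n"
      unfolding coloring_class_iff
    proof (intro conjI)
      show "restrict w {1..n} \<in> {1..n} \<rightarrow>\<^sub>E pverts H"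
        using is_walk_in_verts[OF w(3)] 3 by auto
      show "is_walk H (restrict w {1..n}) 1 n" using w(3) by (auto simp: is_walk_def)
      show "even_linked H c (restrict w {1..n} 1)"
        using x w(1) 3 by (simp add: coloring_class_iff)
    qed
    then show ?thesis using w by (intro bexI[of _ "restrict w {1..n}"]) auto
  qed
qed

text \<open>
This is the counting behind the congestion bound. The state \<open>z\<close> met at a given time shows the middle
part of the canonical walk of \<open>(x, y)\<close>. Missing are about the first \<open>2 * j\<close> letters of \<open>x\<close> and the last
\<open>n - 2 * j\<close> letters of \<open>y\<close>. By \<open>splice_colorings\<close> these fit into a single coloring, except for at most
two letters of \<open>x\<close> and \<open>2 * D\<close> letters of \<open>y\<close>, which are recorded separately. So the number of pairs
is at most a constant times the number of colorings.
\<close>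

lemma fibre_bound:
  assumes D: "walk_threshold D" and n: "n \<ge> 1" and m: "m = (n + D) div 2"
    and w: "\<And>x y i. x \<in> coloring_class H c n \<Longrightarrow> y \<in> coloring_class H c n \<Longrightarrow> i \<in> {1..n} \<Longrightarrow>
       w x y i = x i \<and> w x y (2 * m + i) = y i"
    and jk: "j < m" "1 \<le> k" "k \<le> n"
  shows "card {p \<in> coloring_class H c n \<times> coloring_class H c n.
       window n (w (fst p) (snd p)) (2 * j) k = z} \<le> card (pverts H) ^ (2 + 2 * D) * card (coloring_class H c n)"
    (is "card ?F \<le> _")
proof -
  let ?\<Omega> = "coloring_class H c n"
  let ?I = "{2 * j + 1, 2 * j + 2} \<inter> {1..n}"
  let ?J = "{i. 2 * j < i + D \<and> i < 2 * j + D} \<inter> {1..n}"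
  let ?q = "card (pverts H)"
  have q: "?q \<ge> 1" using has_arc arcs_in_verts finite_verts by (auto simp: Suc_le_eq card_gt_0_iff)
  obtain u where u: "\<And>x y. x \<in> ?\<Omega> \<Longrightarrow> y \<in> ?\<Omega> \<Longrightarrow> u x y \<in> ?\<Omega> \<and>
      (\<forall>i\<in>{1..n}. (i \<le> 2 * j \<longrightarrow> u x y i = x i) \<and> (2 * j + D \<le> i \<longrightarrow> u x y i = y i))"
    using splice_colorings[OF D n, of _ c _ j] by metis
  \<comment> \<open>The merged coloring, and the letters that neither it nor the window \<open>z\<close> shows.\<close>
  define \<Phi> where "\<Phi> p = (u (fst p) (snd p), restrict (fst p) ?I, restrict (snd p) ?J)" for p
  have fin: "finite (?\<Omega> \<times> (?I \<rightarrow>\<^sub>E pverts H) \<times> (?J \<rightarrow>\<^sub>E pverts H))"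
    by (intro finite_cartesian_product finite_PiE finite_coloring_class finite_verts) auto
  have "inj_on \<Phi> ?F"
  proof (rule inj_onI)
    fix p p' assume p: "p \<in> ?F" "p' \<in> ?F" and eq: "\<Phi> p = \<Phi> p'"
    obtain x y x' y' where xy: "p = (x, y)" "p' = (x', y')" by (cases p, cases p') auto
    have mem: "x \<in> ?\<Omega>" "y \<in> ?\<Omega>" "x' \<in> ?\<Omega>" "y' \<in> ?\<Omega>"
      and win: "window n (w x y) (2 * j) k = window n (w x' y') (2 * j) k"
      using p xy by auto
    have eq_u: "u x y = u x' y'" and eq_I: "restrict x ?I = restrict x' ?I"
      and eq_J: "restrict y ?J = restrict y' ?J" using eq xy by (auto simp: \<Phi>_def)
    have x_eq: "x i = x' i" if i: "i \<in> {1..n}" for i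
    proof -
      consider "i \<le> 2 * j" | "i \<in> ?I" | "2 * j + 3 \<le> i" using i by force
      then show ?thesis
      proof cases
        case 1
        then show ?thesis using u[OF mem(1,2)] u[OF mem(3,4)] eq_u i by metis
      next
        case 2
        then show ?thesis using fun_cong[OF eq_I, of i] by simp
      next
        case 3
        then show ?thesis using window_determines[OF win jk(2) 3] w[OF mem(1,2) i] w[OF mem(3,4) i] i by auto
      qed
    qed
    have y_eq: "y i = y' i" if i: "i \<in> {1..n}" for i
    proof -
      consider "2 * j + D \<le> i" | "i \<in> ?J" | "i + D \<le> 2 * j" using i by force
      then show ?thesis
      proof cases
        case 1
        then show ?thesis using u[OF mem(1,2)] u[OF mem(3,4)] eq_u i by metis
      next
        case 2
        then show ?thesis using fun_cong[OF eq_J, of i] by simp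
      next
        case 3
        have "2 * j + 3 \<le> 2 * m + i" "2 * m + i \<le> 2 * j + n" using jk i m 3 by auto
        from window_determines[OF win jk(2) this] show ?thesis
          using w[OF mem(1,2) i] w[OF mem(3,4) i] by simp
      qed
    qed
    have ext: "\<sigma> = \<tau>" if "\<sigma> \<in> ?\<Omega>" "\<tau> \<in> ?\<Omega>" "\<And>i. i \<in> {1..n} \<Longrightarrow> \<sigma> i = \<tau> i" for \<sigma> \<tau>
      using that(1,2) unfolding coloring_class_iff by (elim conjE) (rule PiE_ext[OF _ _ that(3)])
    have "x = x'" "y = y'"
      by (rule ext[OF mem(1,3) x_eq], assumption) (rule ext[OF mem(2,4) y_eq], assumption)
    then show "p = p'" using xy by simp
  qed
  moreover have "\<Phi> ` ?F \<subseteq> ?\<Omega> \<times> (?I \<rightarrow>\<^sub>E pverts H) \<times> (?J \<rightarrow>\<^sub>E pverts H)"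
  proof (rule image_subsetI)
    fix p assume "p \<in> ?F"
    then have mem: "fst p \<in> ?\<Omega>" "snd p \<in> ?\<Omega>" by (simp_all add: mem_Times_iff)
    have "u (fst p) (snd p) \<in> ?\<Omega>" using u[OF mem] by blast
    moreover have "restrict (fst p) ?I \<in> ?I \<rightarrow>\<^sub>E pverts H" "restrict (snd p) ?J \<in> ?J \<rightarrow>\<^sub>E pverts H"
      using class_in_verts[OF mem(1)] class_in_verts[OF mem(2)] unfolding restrict_PiE_iff by blast+
    ultimately show "\<Phi> p \<in> ?\<Omega> \<times> (?I \<rightarrow>\<^sub>E pverts H) \<times> (?J \<rightarrow>\<^sub>E pverts H)"
      unfolding \<Phi>_def by (intro SigmaI)
  qed
  ultimately have "card ?F \<le> card (?\<Omega> \<times> (?I \<rightarrow>\<^sub>E pverts H) \<times> (?J \<rightarrow>\<^sub>E pverts H))"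
    using fin by (rule card_inj_on_le)
  also have "\<dots> = card ?\<Omega> * (?q ^ card ?I * ?q ^ card ?J)"
    unfolding card_cartesian_product by (subst (1 2) card_PiE) auto
  also have "\<dots> \<le> card ?\<Omega> * (?q ^ 2 * ?q ^ (2 * D))"
  proof (rule mult_le_mono2, intro mult_le_mono power_increasing q)
    show "card ?I \<le> 2" by (rule order_trans[OF card_mono[of "{2 * j + 1, 2 * j + 2}"]]) auto
    have "card ?J \<le> card {2 * j - D..<2 * j + D}" by (intro card_mono) auto
    then show "card ?J \<le> 2 * D" by simp
  qed
  finally show ?thesis by (simp only: power_add mult_ac)
qed

text \<open>
The energy of the Glauber dynamics, free of its transition probabilities: proposals at different
vertices and with different colors all have the same probability.
\<close>

definition recoloring_energy :: "'c \<Rightarrow> nat \<Rightarrow> ((nat \<Rightarrow> 'c) \<Rightarrow> real) \<Rightarrow> real" where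
  "recoloring_energy c n f = (\<Sum>v\<in>{1..n}. \<Sum>x\<in>coloring_class H c n. \<Sum>a\<in>pverts H.
     if x(v := a) \<in> coloring_class H c n then (f (x(v := a)) - f x)\<^sup>2 else 0)"

text \<open>
A difference \<open>f x - f y\<close> is telescoped along the canonical path and squared with Cauchy-Schwarz,
which costs the length \<open>m * n\<close> of the path. Each term is bounded by a function of the state met at time \<open>(j, k)\<close>, so
summing over all pairs and applying \<open>fibre_bound\<close> gives at most \<open>card (coloring_class H c n)\<close>, up to a
constant, times the part of the energy due to vertex \<open>k + 1\<close>. The sum over \<open>j\<close> contributes another
factor \<open>m\<close>, and \<open>m\<close> is of order \<open>n\<close>.
\<close>

lemma poincare:
  assumes D: "walk_threshold D" and n: "n \<ge> 1"
  shows "(\<Sum>x\<in>coloring_class H c n. \<Sum>y\<in>coloring_class H c n. (f x - f y)\<^sup>2)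
     \<le> real ((1 + D)\<^sup>2 * card (pverts H) ^ (2 + 2 * D) * n ^ 3 * card (coloring_class H c n))
        * recoloring_energy c n f"
proof -
  let ?\<Omega> = "coloring_class H c n"
  define m where "m = (n + D) div 2"
  define M where "M = card (pverts H) ^ (2 + 2 * D) * card ?\<Omega>"
  define h where "h v x = (\<Sum>a\<in>pverts H. if x(v := a) \<in> ?\<Omega> then (f (x(v := a)) - f x)\<^sup>2 else 0)" for v x
  have h0: "h v x \<ge> 0" for v x unfolding h_def by (intro sum_nonneg) auto
  have D1: "D \<ge> 1" using D by (simp add: walk_threshold_def)
  have "m \<le> n + D" by (simp add: m_def)
  also have "\<dots> \<le> n + D * n" using n by (intro add_left_mono) simp
  finally have m_le: "m \<le> (1 + D) * n" by (simp add: add_mult_distrib)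
  define w where "w x y = (SOME w. (\<forall>i\<in>{1..n}. w i = x i \<and> w (2 * m + i) = y i) \<and>
      is_walk H w 1 (2 * m + n))" for x y
  have w: "\<And>x y. x \<in> ?\<Omega> \<Longrightarrow> y \<in> ?\<Omega> \<Longrightarrow>
      (\<forall>i\<in>{1..n}. w x y i = x i \<and> w x y (2 * m + i) = y i) \<and> is_walk H (w x y) 1 (2 * m + n)"
    unfolding w_def using canonical_walk[OF D n m_def] by (rule someI_ex)
  define Z where "Z p j k = window n (w (fst p) (snd p)) (2 * j) k" for p j k
  have Z_mem: "Z (x, y) j k \<in> ?\<Omega>" if "x \<in> ?\<Omega>" "y \<in> ?\<Omega>" "j < m" for x y j k
  proof -
    have "even_linked H c (w x y 1)"
      using w[OF that(1,2)] that(1) n by (simp add: coloring_class_iff)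
    moreover have "is_walk H (w x y) 1 (2 * m + n)" using w[OF that(1,2)] by blast
    ultimately show ?thesis
      unfolding Z_def fst_conv snd_conv using that(3) n by (intro window_in_class)
  qed
  have path: "(f x - f y)\<^sup>2 \<le> real (m * n) * (\<Sum>j<m. \<Sum>k<n. h (Suc k) (Z (x, y) j (Suc k)))"
    if xy: "x \<in> ?\<Omega>" "y \<in> ?\<Omega>" for x y
  proof -
    let ?d = "\<lambda>(j, k). f (Z (x, y) j k) - f (Z (x, y) j (Suc k))"
    have off: "\<sigma> i = undefined" if "\<sigma> \<in> ?\<Omega>" "i \<notin> {1..n}" for \<sigma> i
      using that PiE_arb unfolding coloring_class_iff by metis
    have "Z (x, y) 0 0 i = x i \<and> Z (x, y) m 0 i = y i" for i
    proof (cases "i \<in> {1..n}")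
      case True
      then show ?thesis using w[OF xy] by (simp add: Z_def window_def)
    next
      case False
      then show ?thesis using off[OF xy(1) False] off[OF xy(2) False] by (auto simp: Z_def window_def)
    qed
    then have start: "Z (x, y) 0 0 = x" and goal: "Z (x, y) m 0 = y" by blast+
    \<comment> \<open>A completed window is the start of the next one.\<close>
    have turn: "Z (x, y) (Suc j) 0 = Z (x, y) j n" for j by (simp add: Z_def window_full)
    have "f x - f y = (\<Sum>j<m. f (Z (x, y) j 0) - f (Z (x, y) (Suc j) 0))"
      using sum_lessThan_telescope'[of "\<lambda>j. f (Z (x, y) j 0)" m] by (simp add: start goal)
    also have "\<dots> = (\<Sum>j<m. \<Sum>k<n. ?d (j, k))"
      unfolding turn
    proof (intro sum.cong refl)
      fix j
      show "f (Z (x, y) j 0) - f (Z (x, y) j n) = (\<Sum>k<n. ?d (j, k))"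
        using sum_lessThan_telescope'[of "\<lambda>k. f (Z (x, y) j k)" n] by simp
    qed
    also have "\<dots> = (\<Sum>e\<in>{..<m} \<times> {..<n}. ?d e)" by (simp add: sum.cartesian_product)
    finally have "(f x - f y)\<^sup>2 \<le> (\<Sum>e\<in>{..<m} \<times> {..<n}. (?d e)\<^sup>2) * card ({..<m} \<times> {..<n})"
      by (simp only: sum_squared_le_sum_of_squares)
    also have "\<dots> = real (m * n) * (\<Sum>j<m. \<Sum>k<n. (?d (j, k))\<^sup>2)"
      by (simp add: sum.cartesian_product case_prod_unfold mult.commute)
    also have "\<dots> \<le> real (m * n) * (\<Sum>j<m. \<Sum>k<n. h (Suc k) (Z (x, y) j (Suc k)))"
    proof (intro mult_left_mono sum_mono)
      fix j k assume "j \<in> {..<m}" "k \<in> {..<n}"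
      then have jk: "j < m" "k < n" by auto
      let ?z = "Z (x, y) j (Suc k)" and ?a = "Z (x, y) j k (Suc k)"
      have upd: "Z (x, y) j k = ?z(Suc k := ?a)"
        using jk window_update[of k n] by (auto simp: Z_def)
      have a: "?a \<in> pverts H"
        using class_in_verts[OF Z_mem[OF xy jk(1)], of "Suc k"] jk(2) by simp
      have "(?d (j, k))\<^sup>2 = (if ?z(Suc k := ?a) \<in> ?\<Omega> then (f (?z(Suc k := ?a)) - f ?z)\<^sup>2 else 0)"
        using Z_mem[OF xy jk(1)] upd by simp
      also have "\<dots> \<le> h (Suc k) ?z"
        unfolding h_def by (rule member_le_sum[OF a]) (auto simp: finite_verts)
      finally show "(?d (j, k))\<^sup>2 \<le> h (Suc k) ?z" .
    qed simp
    finally show ?thesis .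
  qed
  have "(\<Sum>p\<in>?\<Omega> \<times> ?\<Omega>. \<Sum>j<m. \<Sum>k<n. h (Suc k) (Z p j (Suc k)))
      = (\<Sum>j<m. \<Sum>k<n. \<Sum>p\<in>?\<Omega> \<times> ?\<Omega>. h (Suc k) (Z p j (Suc k)))"
    by (subst sum.swap, intro sum.cong refl, rule sum.swap)
  also have "\<dots> \<le> (\<Sum>j<m. \<Sum>k<n. real M * (\<Sum>x\<in>?\<Omega>. h (Suc k) x))"
  proof (intro sum_mono sum_le_fibre_bound)
    fix j k z assume jk: "j \<in> {..<m}" "k \<in> {..<n}"
    show "card {p \<in> ?\<Omega> \<times> ?\<Omega>. Z p j (Suc k) = z} \<le> M"
      unfolding Z_def M_def using w jk by (intro fibre_bound[OF D n m_def]) auto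
    show "(\<lambda>p. Z p j (Suc k)) ` (?\<Omega> \<times> ?\<Omega>) \<subseteq> ?\<Omega>" using Z_mem jk by auto
  qed (auto simp: finite_coloring_class h0)
  also have "\<dots> = real m * real M * (\<Sum>k<n. \<Sum>x\<in>?\<Omega>. h (Suc k) x)"
    by (simp add: sum_distrib_left mult_ac)
  also have "(\<Sum>k<n. \<Sum>x\<in>?\<Omega>. h (Suc k) x) = recoloring_energy c n f"
    unfolding recoloring_energy_def h_def[symmetric]
    by (rule sum.reindex_bij_witness[of _ "\<lambda>v. v - 1" Suc]) auto
  finally have total: "(\<Sum>p\<in>?\<Omega> \<times> ?\<Omega>. \<Sum>j<m. \<Sum>k<n. h (Suc k) (Z p j (Suc k)))
      \<le> real m * real M * recoloring_energy c n f" .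
  have "(\<Sum>x\<in>?\<Omega>. \<Sum>y\<in>?\<Omega>. (f x - f y)\<^sup>2)
      \<le> (\<Sum>x\<in>?\<Omega>. \<Sum>y\<in>?\<Omega>. real (m * n) * (\<Sum>j<m. \<Sum>k<n. h (Suc k) (Z (x, y) j (Suc k))))"
    by (intro sum_mono path)
  also have "\<dots> = real (m * n) * (\<Sum>p\<in>?\<Omega> \<times> ?\<Omega>. \<Sum>j<m. \<Sum>k<n. h (Suc k) (Z p j (Suc k)))"
    by (subst sum.cartesian_product) (simp add: case_prod_unfold flip: sum_distrib_left)
  also have "\<dots> \<le> real (m * n) * (real m * real M * recoloring_energy c n f)"
    using total by (intro mult_left_mono) auto
  also have "\<dots> = real (m * m * n * M) * recoloring_energy c n f" by simp
  also have "\<dots> \<le> real (((1 + D) * n) * ((1 + D) * n) * n * M) * recoloring_energy c n f"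
  proof (rule mult_right_mono)
    show "0 \<le> recoloring_energy c n f" unfolding recoloring_energy_def by (intro sum_nonneg) auto
    show "real (m * m * n * M) \<le> real (((1 + D) * n) * ((1 + D) * n) * n * M)"
      unfolding of_nat_le_iff using m_le by (intro mult_le_mono) auto
  qed
  also have "((1 + D) * n) * ((1 + D) * n) * n * M
      = (1 + D)\<^sup>2 * card (pverts H) ^ (2 + 2 * D) * n ^ 3 * card ?\<Omega>"
    by (simp only: M_def power2_eq_square power3_eq_cube mult_ac)
  finally show ?thesis .
qed

end

section \<open>The Glauber dynamics\<close>

context connected_target
begin

abbreviation path_glauber :: "nat \<Rightarrow> (nat \<Rightarrow> 'c) \<Rightarrow> (nat \<Rightarrow> 'c) pmf" where
  "path_glauber n \<equiv> glauber (path_graph n) H"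

text \<open>
The Metropolis update with the color as an argument. Acceptance is phrased through membership in the
state space, which makes reversibility evident.
\<close>

definition move :: "'c \<Rightarrow> nat \<Rightarrow> nat \<Rightarrow> 'c \<Rightarrow> (nat \<Rightarrow> 'c) \<Rightarrow> (nat \<Rightarrow> 'c)" where
  "move c n v a x = (if x(v := a) \<in> coloring_class H c n then x(v := a) else x)"

text \<open>
Only the arcs at \<open>v\<close> are affected by recoloring \<open>v\<close>, and the path has no loops.
\<close>

lemma proposal_accepted_iff:
  assumes x: "x \<in> colorings (path_graph n) H" and v: "v \<in> {1..n}" and a: "a \<in> pverts H"
  shows "(\<forall>w. (v, w) \<in> parcs (path_graph n) \<longrightarrow> (a, x w) \<in> parcs H)
    \<longleftrightarrow> x(v := a) \<in> colorings (path_graph n) H" (is "?L \<longleftrightarrow> ?R")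
proof
  assume ok: ?L
  have "x(v := a) \<in> pverts (path_graph n) \<rightarrow>\<^sub>E pverts H"
    using x v a unfolding colorings_def path_graph_def by (auto simp: PiE_iff extensional_def)
  moreover have "((x(v := a)) i, (x(v := a)) j) \<in> parcs H" if ij: "(i, j) \<in> parcs (path_graph n)" for i j
  proof -
    have flip: "(j, i) \<in> parcs (path_graph n)" and "i \<noteq> j" using ij by (auto simp: path_graph_def)
    have "(x i, x j) \<in> parcs H" using x ij by (auto simp: colorings_def)
    with \<open>i \<noteq> j\<close> show ?thesis
      using ok ij flip symD[OF sym_arcs] by (cases "i = v"; cases "j = v") auto
  qed
  ultimately show ?R unfolding colorings_def by (auto simp del: fun_upd_apply)
next
  assume R: ?R
  show ?L
  proof (intro allI impI)
    fix w assume vw: "(v, w) \<in> parcs (path_graph n)"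
    then have "w \<noteq> v" by (auto simp: path_graph_def)
    moreover have "((x(v := a)) v, (x(v := a)) w) \<in> parcs H" using R vw unfolding colorings_def by blast
    ultimately show "(a, x w) \<in> parcs H" by simp
  qed
qed

context
  fixes n :: nat and c :: 'c
  assumes n: "n \<ge> 1" and bip_n: "bipartite H \<Longrightarrow> n \<ge> 2" and c: "c \<in> pverts H"
begin

lemma verts_nonempty: "pverts H \<noteq> {}" using c by auto

lemma card_verts_pos: "real (card (pverts H)) > 0"
  using finite_verts verts_nonempty by (simp add: card_gt_0_iff)

lemma glauber_eq_move:
  assumes x: "x \<in> coloring_class H c n"
  shows "path_glauber n x
    = bind_pmf (pmf_of_set {1..n}) (\<lambda>v. map_pmf (\<lambda>a. move c n v a x) (pmf_of_set (pverts H)))"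
proof -
  have col: "x \<in> colorings (path_graph n) H" using x by (simp add: coloring_class_def)
  have "(if \<forall>w. (v, w) \<in> parcs (path_graph n) \<longrightarrow> (a, x w) \<in> parcs H then x(v := a) else x) = move c n v a x"
    if "v \<in> {1..n}" "a \<in> pverts H" for v a
    unfolding proposal_accepted_iff[OF col that] move_def
    using recoloring_stays_in_class[OF n bip_n c x] by (auto simp: coloring_class_def)
  moreover have "set_pmf (pmf_of_set (pverts H)) = pverts H" "set_pmf (pmf_of_set {1..n}) = {1..n}"
    using n finite_verts verts_nonempty by (simp_all add: set_pmf_of_set)
  moreover have "pverts (path_graph n) = {1..n}" by (simp add: path_graph_def)
  ultimately show ?thesis
    unfolding glauber_def metropolis_def by (auto intro!: bind_pmf_cong map_pmf_cong)
qed

lemma move_in_class: "x \<in> coloring_class H c n \<Longrightarrow> move c n v a x \<in> coloring_class H c n"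
  by (simp add: move_def)

lemma set_glauber: "x \<in> coloring_class H c n \<Longrightarrow> set_pmf (path_glauber n x) \<subseteq> coloring_class H c n"
  by (auto simp: glauber_eq_move move_in_class)

lemma pmf_glauber:
  assumes x: "x \<in> coloring_class H c n"
  shows "pmf (path_glauber n x) y
    = (\<Sum>v\<in>{1..n}. \<Sum>a\<in>pverts H. of_bool (move c n v a x = y)) / (n * card (pverts H))"
proof -
  have "pmf (map_pmf (\<lambda>a. move c n v a x) (pmf_of_set (pverts H))) y
      = (\<Sum>a\<in>pverts H. of_bool (move c n v a x = y)) / card (pverts H)" for v
    unfolding map_pmf_def using finite_verts verts_nonempty
    by (simp add: pmf_bind integral_pmf_of_set indicator_def of_bool_def)
  then show ?thesis
    unfolding glauber_eq_move[OF x] using n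
    by (simp add: pmf_bind integral_pmf_of_set sum_divide_distrib mult.commute)
qed

lemma sum_glauber:
  assumes x: "x \<in> coloring_class H c n"
  shows "(\<Sum>y\<in>coloring_class H c n. pmf (path_glauber n x) y * g y)
    = (\<Sum>v\<in>{1..n}. \<Sum>a\<in>pverts H. g (move c n v a x)) / (n * card (pverts H))"
proof -
  let ?\<Omega> = "coloring_class H c n" and ?r = "real (n * card (pverts H))"
  have "(\<Sum>y\<in>?\<Omega>. pmf (path_glauber n x) y * g y)
      = (\<Sum>y\<in>?\<Omega>. \<Sum>v\<in>{1..n}. \<Sum>a\<in>pverts H. of_bool (move c n v a x = y) * g y) / ?r"
    by (simp add: pmf_glauber[OF x] sum_divide_distrib sum_distrib_right)
  also have "(\<Sum>y\<in>?\<Omega>. \<Sum>v\<in>{1..n}. \<Sum>a\<in>pverts H. of_bool (move c n v a x = y) * g y)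
      = (\<Sum>v\<in>{1..n}. \<Sum>a\<in>pverts H. \<Sum>y\<in>?\<Omega>. of_bool (move c n v a x = y) * g y)"
    by (subst sum.swap, intro sum.cong refl, rule sum.swap)
  also have "\<dots> = (\<Sum>v\<in>{1..n}. \<Sum>a\<in>pverts H. g (move c n v a x))"
  proof (intro sum.cong refl)
    fix v a
    have "(\<Sum>y\<in>?\<Omega>. of_bool (move c n v a x = y) * g y)
        = (\<Sum>y\<in>?\<Omega>. if move c n v a x = y then g y else 0)"
      by (intro sum.cong) auto
    then show "(\<Sum>y\<in>?\<Omega>. of_bool (move c n v a x = y) * g y) = g (move c n v a x)"
      using move_in_class[OF x] by (simp add: finite_coloring_class)
  qed
  finally show ?thesis .
qed

text \<open>
If \<open>x\<close> and \<open>y\<close> differ at \<open>v\<close> only, there is exactly one color whose proposal at \<open>v\<close> leads from \<open>x\<close> to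
\<open>y\<close>, and exactly one leading back.
\<close>

lemma glauber_symmetric:
  assumes x: "x \<in> coloring_class H c n" and y: "y \<in> coloring_class H c n"
  shows "pmf (path_glauber n x) y = pmf (path_glauber n y) x"
proof (cases "x = y")
  case False
  have count: "(\<Sum>a\<in>pverts H. of_bool (move c n v a x = y)) = (of_bool (\<forall>i. i \<noteq> v \<longrightarrow> x i = y i) :: real)"
    if v: "v \<in> {1..n}" and x: "x \<in> coloring_class H c n" and y: "y \<in> coloring_class H c n" and "x \<noteq> y" for v x y
  proof -
    have "y v \<in> pverts H" using class_in_verts[OF y v] .
    have "x(v := y v) = y \<longleftrightarrow> (\<forall>i. i \<noteq> v \<longrightarrow> x i = y i)" by (auto simp: fun_eq_iff)
    moreover have "move c n v a x = y \<longleftrightarrow> a = y v \<and> x(v := y v) = y" for a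
      using y \<open>x \<noteq> y\<close> unfolding move_def by (metis fun_upd_same)
    ultimately have "move c n v a x = y \<longleftrightarrow> a = y v \<and> (\<forall>i. i \<noteq> v \<longrightarrow> x i = y i)" for a by simp
    then have "(\<Sum>a\<in>pverts H. of_bool (move c n v a x = y))
        = (\<Sum>a\<in>pverts H. if a = y v then of_bool (\<forall>i. i \<noteq> v \<longrightarrow> x i = y i) else (0::real))"
      by (intro sum.cong) auto
    then show ?thesis using \<open>y v \<in> pverts H\<close> finite_verts by simp
  qed
  have "(\<Sum>v\<in>{1..n}. \<Sum>a\<in>pverts H. of_bool (move c n v a x = y))
      = (\<Sum>v\<in>{1..n}. \<Sum>a\<in>pverts H. of_bool (move c n v a y = x) :: real)"
  proof (rule sum.cong[OF refl])
    fix v assume v: "v \<in> {1..n}"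
    have "(\<forall>i. i \<noteq> v \<longrightarrow> x i = y i) \<longleftrightarrow> (\<forall>i. i \<noteq> v \<longrightarrow> y i = x i)" by metis
    then show "(\<Sum>a\<in>pverts H. of_bool (move c n v a x = y)) = (\<Sum>a\<in>pverts H. of_bool (move c n v a y = x) :: real)"
      using count[OF v x y False] count[OF v y x] False by simp
  qed
  then show ?thesis by (simp add: pmf_glauber x y)
qed simp

text \<open>
Whichever vertex is chosen, proposing its present color changes nothing.
\<close>

lemma glauber_holding:
  assumes x: "x \<in> coloring_class H c n"
  shows "1 / card (pverts H) \<le> pmf (path_glauber n x) x"
proof -
  have "1 \<le> (\<Sum>a\<in>pverts H. of_bool (move c n v a x = x) :: real)" if v: "v \<in> {1..n}" for v
  proof -
    have "x v \<in> pverts H" using class_in_verts[OF x v] .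
    then have "of_bool (move c n v (x v) x = x) \<le> (\<Sum>a\<in>pverts H. of_bool (move c n v a x = x) :: real)"
      by (rule member_le_sum) (auto simp: finite_verts)
    moreover have "move c n v (x v) x = x" by (simp add: move_def)
    ultimately show ?thesis by simp
  qed
  then have "(\<Sum>v\<in>{1..n}. 1) \<le> (\<Sum>v\<in>{1..n}. \<Sum>a\<in>pverts H. of_bool (move c n v a x = x) :: real)"
    by (intro sum_mono)
  then show ?thesis
    using n card_verts_pos by (simp add: pmf_glauber[OF x] field_simps)
qed

lemma glauber_symmetric_chain:
  assumes "coloring_class H c n \<noteq> {}"
  shows "symmetric_chain (coloring_class H c n) (path_glauber n)"
  using assms finite_coloring_class set_glauber glauber_symmetric by unfold_locales auto

lemma energy_glauber:
  assumes "coloring_class H c n \<noteq> {}"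
  shows "n * card (pverts H) * symmetric_chain.energy (coloring_class H c n) (path_glauber n) f
    = recoloring_energy c n f"
proof -
  let ?\<Omega> = "coloring_class H c n"
  interpret symmetric_chain ?\<Omega> "path_glauber n" by (rule glauber_symmetric_chain[OF assms])
  have "n * card (pverts H) * energy f
      = (\<Sum>x\<in>?\<Omega>. \<Sum>v\<in>{1..n}. \<Sum>a\<in>pverts H. (f (move c n v a x) - f x)\<^sup>2)"
    using n card_verts_pos
    by (simp add: energy_def sum_glauber flip: sum_divide_distrib)
  also have "\<dots> = (\<Sum>v\<in>{1..n}. \<Sum>x\<in>?\<Omega>. \<Sum>a\<in>pverts H. (f (move c n v a x) - f x)\<^sup>2)"
    by (rule sum.swap)
  also have "\<dots> = recoloring_energy c n f"
    unfolding recoloring_energy_def by (intro sum.cong) (auto simp: move_def)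
  finally show ?thesis .
qed

text \<open>
One of the factors \<open>n\<close> in \<open>n ^ 4\<close> comes from the choice of the vertex, the other three from
\<open>poincare\<close>; two factors \<open>card (pverts H)\<close> come from the choice of the color and from the holding
probability. Since there are at most \<open>card (pverts H) ^ n\<close> states, starting from a single state costs
one more factor \<open>n\<close>.
\<close>

lemma mixing_time_coloring_class:
  assumes D: "walk_threshold D" and \<epsilon>: "0 < \<epsilon>"
    and t: "0 < t" "(1 + D)\<^sup>2 * card (pverts H) ^ (4 + 2 * D) * n ^ 4
      * (n * ln (card (pverts H)) / 2 + ln (1 / \<epsilon>)) \<le> real t"
  shows "mixing_time (coloring_class H c n) (path_glauber n) (pmf_of_set (coloring_class H c n)) \<epsilon> \<le> enat t"
proof (cases "coloring_class H c n = {}")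
  case True
  then show ?thesis by (simp add: mixing_time_def bot_enat_def)
next
  case False
  let ?\<Omega> = "coloring_class H c n" and ?q = "card (pverts H)"
  interpret symmetric_chain ?\<Omega> "path_glauber n" by (rule glauber_symmetric_chain[OF False])
  define R :: real where "R = (1 + D)\<^sup>2 * ?q ^ (3 + 2 * D) * n ^ 4"
  have R: "R > 0" using n card_verts_pos by (simp add: R_def)
  have R_q: "R / (1 / ?q) = (1 + D)\<^sup>2 * ?q ^ (4 + 2 * D) * n ^ 4"
  proof -
    have "real ?q ^ (4 + 2 * D) = ?q * ?q ^ (3 + 2 * D)" by (simp flip: power_Suc)
    then show ?thesis by (simp add: R_def)
  qed
  have "(\<Sum>x\<in>?\<Omega>. \<Sum>y\<in>?\<Omega>. (f x - f y)\<^sup>2) \<le> R * card ?\<Omega> * energy f" for f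
    using poincare[OF D n, where c = c and f = f]
    by (simp add: R_def power_add eval_nat_numeral mult_ac flip: energy_glauber[OF False, of f])
  moreover have "R / (1 / ?q) * (ln (card ?\<Omega>) / 2 + ln (1 / \<epsilon>)) \<le> t"
  proof -
    have "card ?\<Omega> \<le> card (colorings (path_graph n) H)"
      by (intro card_mono finite_colorings) (auto simp: coloring_class_def)
    then have "card ?\<Omega> \<le> ?q ^ n" using card_colorings_le[of n] by linarith
    then have "real (card ?\<Omega>) \<le> ?q ^ n" by (simp only: of_nat_le_iff)
    moreover have "card ?\<Omega> > 0" using False finite_coloring_class by (simp add: card_gt_0_iff)
    ultimately have "ln (card ?\<Omega>) \<le> ln (real ?q ^ n)" by (intro ln_mono) simp_all
    then have "ln (card ?\<Omega>) \<le> n * ln ?q" using card_verts_pos by (simp add: ln_realpow)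
    then have "R / (1 / ?q) * (ln (card ?\<Omega>) / 2 + ln (1 / \<epsilon>)) \<le> R / (1 / ?q) * (n * ln ?q / 2 + ln (1 / \<epsilon>))"
      using R by (intro mult_left_mono) auto
    then show ?thesis using t(2) unfolding R_q by linarith
  qed
  ultimately show ?thesis
    using glauber_holding R card_verts_pos \<epsilon> t(1)
    by (intro mixing_time_le[where R = R and \<alpha> = "1 / ?q"]) auto
qed

end

end

lemma connected_targetI:
  assumes H: "pair_pseudo_graph H" and conn: "Digraph_Component.connected (with_proj H)"
    and "parcs H \<noteq> {}"
  shows "connected_target H"
proof -
  interpret pair_pseudo_graph H by (rule H)
  have sym: "sym (parcs H)" using pair_sym_arcs by (simp add: symmetric_def)
  have "mk_symmetric (with_proj H) = H"
    using symD[OF sym] by (cases H) (auto simp: mk_symmetric_def)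
  then have "strongly_connected (with_proj H)" using conn by (simp add: Digraph_Component.connected_def)
  then have "(a, b) \<in> (parcs H)\<^sup>*" if "a \<in> pverts H" "b \<in> pverts H" for a b
    using that reachable_rtranclI[of "with_proj H" a b] by (auto simp: strongly_connected_def)
  then show ?thesis
    using assms(3) sym pair_finite_verts in_arcsD1 in_arcsD2 by unfold_locales auto
qed

theorem theorem28:
  fixes H :: "'c pair_pre_digraph" and \<epsilon>\<^sub>0 :: real
  assumes "pair_pseudo_graph H"
    and "Digraph_Component.connected (with_proj H)"
    and "\<epsilon>\<^sub>0 < 1"
  shows "\<exists>C::real. \<forall>(n::nat) \<Omega> (\<epsilon>::real).
           n \<ge> 1 \<longrightarrow> (bipartite H \<longrightarrow> n \<ge> 2) \<longrightarrow> \<Omega> \<in> glauber_state_spaces H n \<longrightarrow>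
           0 < \<epsilon> \<longrightarrow> \<epsilon> \<le> \<epsilon>\<^sub>0 \<longrightarrow>
           ereal_of_enat (mixing_time \<Omega> (glauber (path_graph n) H) (pmf_of_set \<Omega>) \<epsilon>)
             \<le> ereal (C * real n ^ 5 * ln (1 / \<epsilon>))"
proof (cases "parcs H = {}")
  case True
  \<comment> \<open>Then \<open>H\<close> is a single vertex without a loop, and there are no colorings to consider.\<close>
  have bip: "bipartite H"
    unfolding bipartite_def bipartition_def using True by (intro exI[of _ "pverts H"] exI[of _ "{}"]) auto
  have "colorings (path_graph n) H = {}" if "n \<ge> 2" for n
  proof -
    have "(1, 2) \<in> parcs (path_graph n)" using that by (auto simp: path_graph_def)
    then show ?thesis using True by (auto simp: colorings_def)
  qed
  then show ?thesis using bip by (auto simp: glauber_state_spaces_def Let_def)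
next
  case False
  interpret connected_target H by (rule connected_targetI[OF assms(1,2) False])
  obtain D where D: "walk_threshold D"
    using walks_of_all_large_lengths unfolding walk_threshold_def by blast
  define q where "q = real (card (pverts H))"
  define A where "A = (1 + D)\<^sup>2 * q ^ (4 + 2 * D)"
  \<comment> \<open>The summand \<open>1\<close> accounts for rounding the time up to an integer.\<close>
  define B where "B = A * (ln q / 2) + 1"
  \<comment> \<open>As \<open>\<epsilon> \<le> \<epsilon>\<^sub>0 < 1\<close>, the factor \<open>ln (1 / \<epsilon>) / ln (1 / \<epsilon>\<^sub>0)\<close> is at least 1.\<close>
  define C where "C = B / ln (1 / \<epsilon>\<^sub>0) + A"
  have q: "q \<ge> 1"
    using False arcs_in_verts finite_verts by (auto simp: q_def Suc_le_eq card_gt_0_iff)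
  then have A: "A \<ge> 0" and B: "B \<ge> 0" by (auto simp: A_def B_def)
  have "ereal_of_enat (mixing_time \<Omega> (glauber (path_graph n) H) (pmf_of_set \<Omega>) \<epsilon>)
             \<le> ereal (C * real n ^ 5 * ln (1 / \<epsilon>))"
    if n: "n \<ge> 1" "bipartite H \<longrightarrow> n \<ge> 2" and \<Omega>: "\<Omega> \<in> glauber_state_spaces H n"
      and \<epsilon>: "0 < \<epsilon>" "\<epsilon> \<le> \<epsilon>\<^sub>0" for n \<Omega> \<epsilon>
  proof -
    obtain c where c: "c \<in> pverts H" "\<Omega> = coloring_class H c n"
      using glauber_state_space_is_class[OF \<Omega> n(1)] by auto
    define l where "l = ln (1 / \<epsilon>)"
    define l\<^sub>0 where "l\<^sub>0 = ln (1 / \<epsilon>\<^sub>0)"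
    have l: "0 < l\<^sub>0" "l\<^sub>0 \<le> l"
      using \<epsilon> assms(3) by (auto simp: l_def l\<^sub>0_def ln_div)
    define s where "s = A * n ^ 4 * (n * ln q / 2 + l)"
    have s: "s \<ge> 0" using A q l by (simp add: s_def)
    define t where "t = nat \<lfloor>s\<rfloor> + 1"
    have t: "0 < t" "s \<le> t" "t \<le> s + 1" using s by (auto simp: t_def; linarith)+
    have "mixing_time \<Omega> (glauber (path_graph n) H) (pmf_of_set \<Omega>) \<epsilon> \<le> enat t"
      unfolding c(2)
      using t(1,2) n c(1) by (intro mixing_time_coloring_class[OF _ _ _ D \<epsilon>(1)])
        (auto simp: s_def A_def q_def l_def)
    then have "ereal_of_enat (mixing_time \<Omega> (glauber (path_graph n) H) (pmf_of_set \<Omega>) \<epsilon>) \<le> ereal t"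
      using ereal_of_enat_le_iff[of _ "enat t"] by simp
    also have "real t \<le> C * real n ^ 5 * ln (1 / \<epsilon>)"
    proof -
      have n1: "real n \<ge> 1" using n by simp
      have "real n ^ 4 \<le> real n ^ 5" using n1 by (intro power_increasing) auto
      then have "A * l * real n ^ 4 \<le> A * l * real n ^ 5" using A l by (intro mult_left_mono) auto
      moreover have "1 \<le> real n ^ 5" using n1 by (rule one_le_power)
      moreover have "s = A * (ln q / 2) * real n ^ 5 + A * l * real n ^ 4"
        by (simp add: s_def algebra_simps eval_nat_numeral)
      ultimately have "real t \<le> B * real n ^ 5 + A * l * real n ^ 5"
        using t(3) by (simp add: B_def algebra_simps)
      also have "B * real n ^ 5 \<le> B / l\<^sub>0 * real n ^ 5 * l"
      proof -
        have "B * real n ^ 5 * l\<^sub>0 \<le> B * real n ^ 5 * l" using B l by (intro mult_left_mono) auto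
        then show ?thesis using l by (simp add: field_simps)
      qed
      finally show ?thesis by (simp add: C_def l_def l\<^sub>0_def algebra_simps)
    qed
    finally show ?thesis by simp
  qed
  then show ?thesis by blast
qed

end
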